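(* Let $G$ be a plane graph whose outer face is bounded by the cycle $v_1v_2\dots v_kv_1$, with $V(G)=\{v_1,\dots,v_k,u,v\}$ where $u,v$ lie inside the cycle, and suppose there is $3\le i\le k-1$ such that $N_G(u)=\{v,v_1,\dots,v_i\}$ and $N_G(v)=\{u,v_i,\dots,v_k,v_1\}$. Then $P(G-\overrightarrow{v_kv_1v_2})$ contains a non-vanishing monomial $\eta\, v_1^0v_2^0v_k^0v^{\alpha_v}u^{\alpha_u}\prod_{r=3}^{k-1}v_r^{\alpha_r}$ with $\alpha_r\le2$ and $\alpha_v,\alpha_u\le4$.
   Context: For a graph $G$, vertices are also variables and $P(G)=\prod_{xy\in E(G),\,x<y}(x-y)$ for a fixed arbitrary orientation; a monomial is non-vanishing if its coefficient is nonzero. $G-\overrightarrow{v_kv_1v_2}$ is $G$ with edges $v_kv_1,v_1v_2$ deleted (vertices kept). *)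

theory Defs
  imports "HOL-Analysis.Analysis" "HOL-Library.Poly_Mapping"
begin

section \<open>Finite simple graphs and their drawings in the plane\<close>

locale simple_graph =
  fixes V :: "'a set" and E :: "'a set set"
  assumes finite_V: "finite V"
    and edge_subset: "e \<in> E \<Longrightarrow> e \<subseteq> V"
    and edge_card: "e \<in> E \<Longrightarrow> card e = 2"

definition neighbourhood :: "'a set set \<Rightarrow> 'a \<Rightarrow> 'a set" where
  "neighbourhood E x = {y. {x, y} \<in> E}"

text \<open>A plane graph is a simple graph together with a drawing: \<open>pos\<close> places the vertices at
  distinct points of the plane and \<open>\<gamma> e\<close> is an arc joining the two ends of the edge \<open>e\<close>.
  The interior of an edge contains no vertex and no point of another edge. The plane is
  \<^typ>\<open>complex\<close>, the type for which the library states the Jordan curve theorem.\<close>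

locale plane_graph = simple_graph V E
  for V :: "'a set" and E :: "'a set set" +
  fixes pos :: "'a \<Rightarrow> complex" and \<gamma> :: "'a set \<Rightarrow> real \<Rightarrow> complex"
  assumes inj_pos: "inj_on pos V"
    and arc_edge: "e \<in> E \<Longrightarrow> arc (\<gamma> e)"
    and edge_ends: "e \<in> E \<Longrightarrow> {pathstart (\<gamma> e), pathfinish (\<gamma> e)} = pos ` e"
    and interior_vertices: "e \<in> E \<Longrightarrow> (path_image (\<gamma> e) - pos ` e) \<inter> pos ` V = {}"
    and interior_edges:
      "e \<in> E \<Longrightarrow> f \<in> E \<Longrightarrow> e \<noteq> f \<Longrightarrow> (path_image (\<gamma> e) - pos ` e) \<inter> path_image (\<gamma> f) = {}"

definition edge_points :: "('a set \<Rightarrow> real \<Rightarrow> complex) \<Rightarrow> 'a set set \<Rightarrow> complex set" where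
  "edge_points \<gamma> F = (\<Union>e\<in>F. path_image (\<gamma> e))"

text \<open>The outer face is the unbounded connected component of the complement of the drawing; since
  the drawing is compact there is exactly one, and it is \<^const>\<open>outside\<close> of the drawing.\<close>

definition outer_face ::
    "'a set \<Rightarrow> 'a set set \<Rightarrow> ('a \<Rightarrow> complex) \<Rightarrow> ('a set \<Rightarrow> real \<Rightarrow> complex) \<Rightarrow> complex set" where
  "outer_face V E pos \<gamma> = outside (pos ` V \<union> edge_points \<gamma> E)"

text \<open>Cycles are given by sequences \<open>w 1, \<dots>, w k\<close>, indexed from 1.\<close>

definition cycle_edges :: "(nat \<Rightarrow> 'a) \<Rightarrow> nat \<Rightarrow> 'a set set" where
  "cycle_edges w k = {{w j, w (j + 1)} |j. 1 \<le> j \<and> j < k} \<union> {{w k, w 1}}"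

definition is_cycle :: "'a set set \<Rightarrow> (nat \<Rightarrow> 'a) \<Rightarrow> nat \<Rightarrow> bool" where
  "is_cycle E w k \<longleftrightarrow> 3 \<le> k \<and> inj_on w {1..k} \<and> cycle_edges w k \<subseteq> E"


section \<open>The graph polynomial\<close>

text \<open>Multivariate polynomials with variables \<^typ>\<open>'a\<close> and coefficients \<^typ>\<open>'b\<close> are finitely
  supported maps from exponent vectors (themselves finitely supported) to coefficients, with the
  convolution product of \<^theory>\<open>HOL-Library.Poly_Mapping\<close>.\<close>

type_synonym ('a, 'b) mpolynomial = "('a \<Rightarrow>\<^sub>0 nat) \<Rightarrow>\<^sub>0 'b"

definition var :: "'a \<Rightarrow> ('a, 'b::comm_ring_1) mpolynomial" where
  "var x = Poly_Mapping.single (Poly_Mapping.single x 1) 1"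

text \<open>An orientation is a relation \<open>lt\<close> that holds in exactly one direction along every edge
  (it need not be an order).\<close>

definition orientation :: "'a set set \<Rightarrow> ('a \<Rightarrow> 'a \<Rightarrow> bool) \<Rightarrow> bool" where
  "orientation E lt \<longleftrightarrow> (\<forall>x y. {x, y} \<in> E \<longrightarrow> (lt x y \<longleftrightarrow> \<not> lt y x))"

definition graph_poly ::
    "('a \<Rightarrow> 'a \<Rightarrow> bool) \<Rightarrow> 'a set set \<Rightarrow> ('a, 'b::comm_ring_1) mpolynomial" where
  "graph_poly lt E = (\<Prod>(x, y) \<in> {(x, y). {x, y} \<in> E \<and> lt x y}. var x - var y)"

definition nonvanishing_monomial :: "('a, 'b::comm_ring_1) mpolynomial \<Rightarrow> ('a \<Rightarrow>\<^sub>0 nat) \<Rightarrow> bool" where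
  "nonvanishing_monomial p m \<longleftrightarrow> Poly_Mapping.lookup p m \<noteq> 0"

end

theory Submission
  imports Defs
begin

text \<open>The cycle has no chord: the exterior of the cycle is the outer face, and a chord inside would,
  by the theta-curve theorem, separate a vertex of the cycle from the region containing the adjacent
  vertices \<open>u\<close> and \<open>v\<close>, although every vertex of the cycle is a neighbour of one of them. So the edges of the
  graph are known, and the coefficient of \<open>v\<^sub>3\<^sup>2 \<cdots> v\<^bsub>k-1\<^esub>\<^sup>2\<close> times \<open>u\<^sup>4 v\<^sup>3\<close> (\<open>i\<close> even) or
  \<open>u\<^sup>3 v\<^sup>4\<close> (\<open>i\<close> odd) is computed by eliminating one variable at a time. Setting \<open>v\<^sub>1\<close>, \<open>v\<^sub>2\<close>, \<open>v\<^sub>k\<close> to 0 leaves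
  the factors \<open>v\<^sub>3\<close> and \<open>v\<^bsub>k-1\<^esub>\<close> at the two ends of the path. Extracting the square of \<open>x\<close> from
  \<open>(\<epsilon>u + x)(x - y)(u - x)\<close> with \<open>\<epsilon> \<in> {0, 1}\<close> gives \<open>(1 - \<epsilon>)u + y\<close>, so the factor travels along the
  path from either end until both meet at \<open>v\<^sub>i\<close>. What remains is
  \<open>u\<^sup>2 v\<^sup>2 (u - v)\<close> times the coefficient of \<open>x\<^sup>2\<close> in \<open>(\<epsilon>u + x)(\<delta>v + x)(u - x)(v - x)\<close>.\<close>

section \<open>Extracting coefficients\<close>

definition free_of :: "'a \<Rightarrow> ('a, 'b::comm_ring_1) mpolynomial \<Rightarrow> bool" where
  "free_of x p \<longleftrightarrow> (\<forall>m \<in> Poly_Mapping.keys p. Poly_Mapping.lookup m x = 0)"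

lemma free_of_0: "free_of x 0"
  by (simp add: free_of_def)

lemma free_of_1: "free_of x 1"
  by (simp add: free_of_def)

lemma free_of_var: "x \<noteq> y \<Longrightarrow> free_of x (var y)"
  by (simp add: free_of_def var_def lookup_single)

lemma free_of_add: "free_of x p \<Longrightarrow> free_of x q \<Longrightarrow> free_of x (p + q)"
  using keys_add[of p q] by (fastforce simp: free_of_def)

lemma free_of_minus: "free_of x p \<Longrightarrow> free_of x (- p)"
  by (simp add: free_of_def in_keys_iff)

lemma free_of_diff: "free_of x p \<Longrightarrow> free_of x q \<Longrightarrow> free_of x (p - q)"
  using free_of_add[OF _ free_of_minus, of x p q] by simp

lemma free_of_mult: "free_of x p \<Longrightarrow> free_of x q \<Longrightarrow> free_of x (p * q)"
  using keys_mult[of p q] by (fastforce simp: free_of_def lookup_add)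

lemma free_of_power: "free_of x p \<Longrightarrow> free_of x (p ^ n)"
  by (induction n) (auto intro: free_of_1 free_of_mult)

lemma free_of_prod: "(\<And>a. a \<in> A \<Longrightarrow> free_of x (f a)) \<Longrightarrow> free_of x (prod f A)"
  by (induction A rule: infinite_finite_induct) (auto intro: free_of_1 free_of_mult)

lemmas free_of_intros = free_of_0 free_of_1 free_of_var free_of_add free_of_minus free_of_diff
  free_of_mult free_of_power free_of_prod

lemma lookup_single_mult_add:
  fixes p :: "('a, 'b::comm_ring_1) mpolynomial"
  shows "Poly_Mapping.lookup (Poly_Mapping.single t 1 * p) (t + m) = Poly_Mapping.lookup p m"
  by (simp add: lookup_mult lookup_single when_mult)

lemma var_power: "(var x :: ('a, 'b::comm_ring_1) mpolynomial) ^ d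
    = Poly_Mapping.single (Poly_Mapping.single x d) 1"
  by (induction d) (simp_all add: var_def mult_single flip: single_add)

text \<open>Every monomial of \<open>var x ^ d * p\<close> has exponent exactly \<open>d\<close> at
  \<open>x\<close>, because \<open>p\<close> contributes nothing there. For \<open>d = e\<close> the
  power of \<open>x\<close> cancels; otherwise the exponents at \<open>x\<close> disagree.\<close>

lemma lookup_var_power_mult:
  fixes p :: "('a, 'b::comm_ring_1) mpolynomial"
  assumes "free_of x p" and "Poly_Mapping.lookup m x = 0"
  shows "Poly_Mapping.lookup (var x ^ d * p) (m + Poly_Mapping.single x e)
    = (if d = e then Poly_Mapping.lookup p m else 0)"
proof (cases "d = e")
  case True
  then show ?thesis
    by (simp add: var_power lookup_single_mult_add add.commute[of m])
next
  case False
  have "m + Poly_Mapping.single x e \<notin> Poly_Mapping.keys (var x ^ d * p)"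
  proof
    assume "m + Poly_Mapping.single x e \<in> Poly_Mapping.keys (var x ^ d * p)"
    then obtain q where q: "q \<in> Poly_Mapping.keys p"
        "m + Poly_Mapping.single x e = Poly_Mapping.single x d + q"
      using keys_mult[of "var x ^ d" p] by (auto simp: var_power split: if_splits)
    have "Poly_Mapping.lookup q x = 0"
      using q(1) assms(1) by (simp add: free_of_def)
    with q(2) assms(2) False show False
      by (metis add.right_neutral add_0 lookup_add lookup_single_eq)
  qed
  with False show ?thesis
    by (simp add: in_keys_iff)
qed

text \<open>Only the summand with \<open>d = e\<close> can produce the exponent \<open>e\<close> of
  \<open>x\<close>, so one variable disappears from the problem.\<close>

lemma lookup_coefficient:
  fixes p :: "('a, 'b::comm_ring_1) mpolynomial"
  assumes "p = (\<Sum>d\<le>N. var x ^ d * a d)" and "\<And>d. d \<le> N \<Longrightarrow> free_of x (a d)"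
    and "Poly_Mapping.lookup m x = 0" and "e \<le> N"
  shows "Poly_Mapping.lookup p (m + Poly_Mapping.single x e) = Poly_Mapping.lookup (a e) m"
proof -
  have "Poly_Mapping.lookup p (m + Poly_Mapping.single x e)
      = (\<Sum>d\<le>N. if d = e then Poly_Mapping.lookup (a d) m else 0)"
    unfolding assms(1) lookup_sum using assms(2,3)
    by (intro sum.cong refl lookup_var_power_mult) auto
  with assms(4) show ?thesis by simp
qed

text \<open>This amounts to substituting 0 for \<open>x\<close>. Degree 2 suffices for
  \<open>w 1\<close>, \<open>w 2\<close> and \<open>w k\<close>, each of which lies on two edges
  after the deletion.\<close>

lemma lookup_coefficient_0:
  fixes p :: "('a, 'b::comm_ring_1) mpolynomial"
  assumes "p = a + var x * b + var x ^ 2 * c"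
    and "free_of x a" "free_of x b" "free_of x c" and "Poly_Mapping.lookup m x = 0"
  shows "Poly_Mapping.lookup p m = Poly_Mapping.lookup a m"
proof -
  have "Poly_Mapping.lookup p (m + Poly_Mapping.single x 0) = Poly_Mapping.lookup ([a, b, c] ! 0) m"
  proof (rule lookup_coefficient[where N = 2])
    show "p = (\<Sum>d\<le>2. var x ^ d * [a, b, c] ! d)"
      by (simp add: assms(1) numeral_eq_Suc)
    show "free_of x ([a, b, c] ! d)" if "d \<le> 2" for d
      using assms(2-4) that by (auto simp: numeral_eq_Suc le_Suc_eq)
  qed (use assms in auto)
  then show ?thesis by simp
qed

text \<open>Degree 4 is what the common end of two fans produces; an earlier path vertex of a fan
  produces degree 3 and takes \<open>a4 = 0\<close>.\<close>

lemma lookup_coefficient_2: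
  fixes p :: "('a, 'b::comm_ring_1) mpolynomial"
  assumes "p = a0 + var x * a1 + var x ^ 2 * a2 + var x ^ 3 * a3 + var x ^ 4 * a4"
    and "free_of x a0" "free_of x a1" "free_of x a2" "free_of x a3" "free_of x a4"
    and "Poly_Mapping.lookup m x = 0"
  shows "Poly_Mapping.lookup p (m + Poly_Mapping.single x 2) = Poly_Mapping.lookup a2 m"
proof -
  have "Poly_Mapping.lookup p (m + Poly_Mapping.single x 2)
      = Poly_Mapping.lookup ([a0, a1, a2, a3, a4] ! 2) m"
  proof (rule lookup_coefficient[where N = 4])
    show "p = (\<Sum>d\<le>4. var x ^ d * [a0, a1, a2, a3, a4] ! d)"
      by (simp add: assms(1) numeral_eq_Suc)
    show "free_of x ([a0, a1, a2, a3, a4] ! d)" if "d \<le> 4" for d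
      using assms(2-6) that by (auto simp: numeral_eq_Suc le_Suc_eq)
  qed (use assms in auto)
  then show ?thesis by simp
qed

section \<open>Eliminating the variables along a fan\<close>

text \<open>The path vertices are eliminated from \<open>x 0\<close> on. The coefficient of
  \<open>X ^ 2\<close> in \<open>(X - Y) * (H - X) * (e + X)\<close> is \<open>H + Y - e\<close>,
  and passing from \<open>e\<close> to \<open>H - e\<close> exchanges 0 and \<open>H\<close>; hence
  the dependence on the parity of \<open>n\<close>. The factor \<open>B\<close> holds everything
  that avoids the eliminated vertices.\<close>

lemma lookup_fan:
  fixes B :: "('a, 'b::comm_ring_1) mpolynomial" and x :: "nat \<Rightarrow> 'a"
  assumes "inj_on x {..n}" and "h \<notin> x ` {..n}"
    and "\<And>j. j < n \<Longrightarrow> free_of (x j) B" and "\<And>j. j < n \<Longrightarrow> Poly_Mapping.lookup m (x j) = 0"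
  shows "Poly_Mapping.lookup
      (B * (var (x 0) * (\<Prod>j<n. (var (x j) - var (x (Suc j))) * (var h - var (x j)))))
      (m + (\<Sum>j<n. Poly_Mapping.single (x j) 2))
    = Poly_Mapping.lookup (B * ((if odd n then var h else 0) + var (x n))) m"
  using assms
proof (induction n arbitrary: B m)
  case 0
  then show ?case by simp
next
  case (Suc n)
  define e :: "('a, 'b) mpolynomial" where "e = (if odd n then var h else 0)"
  define e' :: "('a, 'b) mpolynomial" where "e' = (if odd (Suc n) then var h else 0)"
  define X Y H :: "('a, 'b) mpolynomial" where "X = var (x n)" and "Y = var (x (Suc n))" and "H = var h"
  have ne: "x j \<noteq> x l" if "j < l" "l \<le> Suc n" for j l
    using Suc.prems(1) that by (auto dest!: inj_onD)
  have nh: "x j \<noteq> h" if "j \<le> Suc n" for j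
    using Suc.prems(2) that by auto
  \<comment> \<open>The last path edge and the last spoke involve no path vertex before
    \<open>x n\<close>, so they can join the arbitrary factor of the induction hypothesis.\<close>
  let ?B = "B * ((X - Y) * (H - X))"
  have fB: "free_of (x j) ?B" if "j < n" for j
    using Suc.prems(3)[of j] that ne[of j n] ne[of j "Suc n"] nh[of j]
    by (auto simp: X_def Y_def H_def intro!: free_of_intros)
  have "Poly_Mapping.lookup
      (B * (var (x 0) * (\<Prod>j<Suc n. (var (x j) - var (x (Suc j))) * (var h - var (x j)))))
      (m + (\<Sum>j<Suc n. Poly_Mapping.single (x j) 2))
    = Poly_Mapping.lookup
      (?B * (var (x 0) * (\<Prod>j<n. (var (x j) - var (x (Suc j))) * (var h - var (x j)))))
      ((m + Poly_Mapping.single (x n) 2) + (\<Sum>j<n. Poly_Mapping.single (x j) 2))"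
    by (simp add: X_def Y_def H_def ac_simps)
  also have "\<dots> = Poly_Mapping.lookup (?B * (e + X)) (m + Poly_Mapping.single (x n) 2)"
    unfolding e_def X_def
  proof (rule Suc.IH)
    show "inj_on x {..n}"
      using Suc.prems(1) by (rule inj_on_subset) auto
    show "h \<notin> x ` {..n}"
      using Suc.prems(2) by auto
    show "Poly_Mapping.lookup (m + Poly_Mapping.single (x n) 2) (x j) = 0" if "j < n" for j
      using Suc.prems(4)[of j] that ne[of j n] by (simp add: lookup_add lookup_single)
  qed (use fB in \<open>simp add: X_def\<close>)
  also have "\<dots> = Poly_Mapping.lookup (B * (e' + Y)) m"
  proof (rule lookup_coefficient_2)
    have "(X - Y) * (H - X) * (e + X)
        = - (Y * H * e) + X * (H * e + Y * e - Y * H) + X ^ 2 * (H + Y - e) + X ^ 3 * (- 1)"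
      by (simp add: algebra_simps power2_eq_square power3_eq_cube)
    moreover have "H + Y - e = e' + Y"
      by (simp add: e_def e'_def H_def)
    ultimately have "(X - Y) * (H - X) * (e + X)
        = - (Y * H * e) + X * (H * e + Y * e - Y * H) + X ^ 2 * (e' + Y) + X ^ 3 * (- 1)"
      by simp
    then have "B * ((X - Y) * (H - X)) * (e + X)
        = B * (- (Y * H * e) + X * (H * e + Y * e - Y * H) + X ^ 2 * (e' + Y) + X ^ 3 * (- 1))"
      by (simp only: mult.assoc)
    then show "?B * (e + X) = B * (- (Y * H * e)) + var (x n) * (B * (H * e + Y * e - Y * H))
        + var (x n) ^ 2 * (B * (e' + Y)) + var (x n) ^ 3 * (B * (- 1)) + var (x n) ^ 4 * 0"
      by (simp add: X_def algebra_simps)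
  qed (use Suc.prems(3)[of n] Suc.prems(4)[of n] ne[of n "Suc n"] nh[of n] in
        \<open>auto simp: Y_def H_def e_def e'_def intro!: free_of_intros\<close>)
  finally show ?case
    by (simp add: e'_def Y_def)
qed

section \<open>Two fans with a common end\<close>

lemma lookup_var_powers:
  assumes "u \<noteq> v"
  shows "Poly_Mapping.lookup (var u ^ a * var v ^ b :: ('a, 'b::comm_ring_1) mpolynomial)
     (Poly_Mapping.single u c + Poly_Mapping.single v d) = (if a = c \<and> b = d then 1 else 0)"
proof -
  have "Poly_Mapping.lookup (var u ^ a * var v ^ b :: ('a, 'b) mpolynomial)
     (Poly_Mapping.single v d + Poly_Mapping.single u c)
    = (if a = c then Poly_Mapping.lookup (var v ^ b * 1 :: ('a, 'b) mpolynomial) (0 + Poly_Mapping.single v d) else 0)"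
    using assms by (subst lookup_var_power_mult) (auto intro!: free_of_intros simp: lookup_single)
  also have "\<dots> = (if a = c \<and> b = d then 1 else 0)"
    by (subst lookup_var_power_mult) (auto intro!: free_of_intros)
  finally show ?thesis by (simp add: add.commute)
qed

lemma lookup_var_powers_diff:
  assumes "u \<noteq> v"
  defines "U \<equiv> (var u :: ('a, 'b::comm_ring_1) mpolynomial)" and "V \<equiv> var v"
  shows "Poly_Mapping.lookup (U ^ a * V ^ b * (U - V))
      (Poly_Mapping.single u c + Poly_Mapping.single v d)
    = (if Suc a = c \<and> b = d then 1 else 0) - (if a = c \<and> Suc b = d then 1 else 0)"
proof -
  have "U ^ a * V ^ b * (U - V) = U ^ Suc a * V ^ b - U ^ a * V ^ Suc b"
    by (simp add: algebra_simps)
  then show ?thesis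
    by (simp only: U_def V_def lookup_minus lookup_var_powers[OF assms(1)])
qed

text \<open>\<open>F\<close> and \<open>G\<close> are fans with hubs \<open>u\<close> and
  \<open>v\<close> whose paths end at \<open>z\<close>; \<open>U ^ 2 * V ^ 2\<close> is what the
  vertices set to 0 will leave behind. Eliminating both fans and then \<open>z\<close> gives a
  polynomial in \<open>U\<close> and \<open>V\<close> alone, which is inspected for each parity of
  \<open>a\<close> and \<open>b\<close>.\<close>

lemma lookup_double_fan:
  fixes x y :: "nat \<Rightarrow> 'a" and a b :: nat and u v z :: 'a
  defines "U \<equiv> (var u :: ('a, 'b::comm_ring_1) mpolynomial)" and "V \<equiv> var v" and "Z \<equiv> var z"
    and "F \<equiv> var (x 0) * (\<Prod>j<a. (var (x j) - var (x (Suc j))) * (var u - var (x j)))"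
    and "G \<equiv> var (y 0) * (\<Prod>j<b. (var (y j) - var (y (Suc j))) * (var v - var (y j)))"
  assumes inj: "inj_on x {..a}" "inj_on y {..b}" and ends: "x a = z" "y b = z"
    and dis: "x ` {..<a} \<inter> y ` {..b} = {}"
    and "u \<noteq> v" and u: "u \<notin> x ` {..a} \<union> y ` {..b}" and v: "v \<notin> x ` {..a} \<union> y ` {..b}"
  shows "Poly_Mapping.lookup (U ^ 2 * V ^ 2 * (U - V) * F * G * ((U - Z) * (V - Z)))
      ((if odd a then Poly_Mapping.single u 4 + Poly_Mapping.single v 3
        else Poly_Mapping.single u 3 + Poly_Mapping.single v 4)
       + Poly_Mapping.single z 2 + (\<Sum>j<b. Poly_Mapping.single (y j) 2)
       + (\<Sum>j<a. Poly_Mapping.single (x j) 2)) \<in> {1, - 1}" (is "?L \<in> _")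
proof -
  define s where "s = (if odd a then Poly_Mapping.single u 4 + Poly_Mapping.single v 3
        else Poly_Mapping.single u (3::nat) + Poly_Mapping.single v 4)"
  define d e :: "('a, 'b) mpolynomial"
    where "d = (if odd a then U else 0)" and "e = (if odd b then V else 0)"
  let ?P = "U ^ 2 * V ^ 2 * (U - V)"
  have xx: "x j \<noteq> x l" if "j < l" "l \<le> a" for j l
    using inj(1) that by (auto dest!: inj_onD)
  have yy: "y j \<noteq> y l" if "j < l" "l \<le> b" for j l
    using inj(2) that by (auto dest!: inj_onD)
  have xy: "x j \<noteq> y l" if "j < a" "l \<le> b" for j l
    using dis that by auto
  have un: "x j \<noteq> u" "y l \<noteq> u" "x j \<noteq> v" "y l \<noteq> v" if "j \<le> a" "l \<le> b" for j l
    using u v that by auto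
  have zn: "z \<noteq> u" "z \<noteq> v"
    using un[of a b] ends by auto
  have xz: "x j \<noteq> z" if "j < a" for j using xx[of j a] that ends by auto
  have yz: "y j \<noteq> z" if "j < b" for j using yy[of j b] that ends by auto
  have sx: "Poly_Mapping.lookup s t = 0" if "t \<noteq> u" "t \<noteq> v" for t
    using that by (simp add: s_def lookup_add lookup_single)
  have free: "free_of z U" "free_of z V" "free_of z d" "free_of z e"
    using zn by (auto simp: U_def V_def d_def e_def intro!: free_of_intros)
  have "?L = Poly_Mapping.lookup (?P * G * ((U - Z) * (V - Z)) * F)
      (s + Poly_Mapping.single z 2 + (\<Sum>j<b. Poly_Mapping.single (y j) 2)
        + (\<Sum>j<a. Poly_Mapping.single (x j) 2))"
    by (simp add: s_def ac_simps)
  \<comment> \<open>The fan at \<open>u\<close> goes first, with \<open>G\<close> in the role of a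
    constant: no \<open>x j\<close> with \<open>j < a\<close> lies on the other path.\<close>
  also have "\<dots> = Poly_Mapping.lookup (?P * G * ((U - Z) * (V - Z)) * (d + Z))
      (s + Poly_Mapping.single z 2 + (\<Sum>j<b. Poly_Mapping.single (y j) 2))"
    unfolding F_def d_def U_def Z_def ends(1)[symmetric]
  proof (rule lookup_fan)
    show "u \<notin> x ` {..a}" using u by auto
    show "Poly_Mapping.lookup (s + Poly_Mapping.single (x a) 2 + (\<Sum>j<b. Poly_Mapping.single (y j) 2)) (x j) = 0"
      if "j < a" for j
      using that xy[of j, THEN not_sym] xx[of j a] un[of j 0] sx[of "x j"]
      by (auto simp: lookup_add lookup_single lookup_sum when_def intro!: sum.neutral)
    fix j assume "j < a"
    then show "free_of (x j) ((var u)\<^sup>2 * V\<^sup>2 * (var u - V) * G * ((var u - var (x a)) * (V - var (x a))))"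
      using xx[of j a] un[of j 0]
      by (auto simp: G_def V_def xy intro!: free_of_intros)
  qed (rule inj)
  also have "\<dots> = Poly_Mapping.lookup (?P * ((U - Z) * (V - Z)) * (d + Z) * G)
      (s + Poly_Mapping.single z 2 + (\<Sum>j<b. Poly_Mapping.single (y j) 2))"
    by (simp add: ac_simps)
  also have "\<dots> = Poly_Mapping.lookup (?P * ((U - Z) * (V - Z)) * (d + Z) * (e + Z))
      (s + Poly_Mapping.single z 2)"
    unfolding G_def e_def V_def Z_def ends(2)[symmetric]
  proof (rule lookup_fan)
    show "v \<notin> y ` {..b}" using v by auto
    show "Poly_Mapping.lookup (s + Poly_Mapping.single (y b) 2) (y j) = 0" if "j < b" for j
      using that yy[of j b] un[of 0 j] sx[of "y j"]
      by (auto simp: lookup_add lookup_single)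
    fix j assume "j < b"
    then show "free_of (y j) (U\<^sup>2 * (var v)\<^sup>2 * (U - var v) * ((U - var (y b)) * (var v - var (y b))) * (d + var (y b)))"
      using yy[of j b] un[of 0 j]
      by (auto simp: d_def U_def intro!: free_of_intros)
  qed (rule inj)
  \<comment> \<open>The factor beside \<open>?P\<close> is the coefficient of \<open>Z ^ 2\<close>
    in \<open>(U - Z) * (V - Z) * (d + Z) * (e + Z)\<close>.\<close>
  also have "\<dots> = Poly_Mapping.lookup (?P * (U * V + d * e - (U + V) * (d + e))) s"
  proof (rule lookup_coefficient_2)
    show "?P * ((U - Z) * (V - Z)) * (d + Z) * (e + Z)
      = ?P * (U * V * d * e) + var z * (?P * (U * V * (d + e) - (U + V) * d * e))
        + var z ^ 2 * (?P * (U * V + d * e - (U + V) * (d + e)))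
        + var z ^ 3 * (?P * (d + e - U - V)) + var z ^ 4 * ?P"
      unfolding Z_def[symmetric] by (simp add: algebra_simps numeral_eq_Suc)
  qed (use free zn sx in \<open>auto intro!: free_of_intros\<close>)
  \<comment> \<open>The factor beside \<open>?P\<close> is \<open>- (U ^ 2) - V ^ 2\<close> or
    \<open>- (U ^ 2)\<close> for odd \<open>a\<close>, and \<open>- (V ^ 2)\<close> or
    \<open>U * V\<close> for even \<open>a\<close>, the first value belonging to odd
    \<open>b\<close>. The coefficient is 1 for odd \<open>a\<close> and -1 for even
    \<open>a\<close>.\<close>
  also have "\<dots> \<in> {1, - 1}"
  proof (cases "odd a")
    case True
    have *: "U * V + d * e - (U + V) * (d + e) = (if odd b then - (U ^ 2) - V ^ 2 else - (U ^ 2))"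
      using True by (simp add: d_def e_def algebra_simps power2_eq_square)
    have "?P * (- (U ^ 2) - V ^ 2) = - (U ^ 4 * V ^ 2 * (U - V)) - U ^ 2 * V ^ 4 * (U - V)"
         "?P * (- (U ^ 2)) = - (U ^ 4 * V ^ 2 * (U - V))"
      by (simp_all add: algebra_simps numeral_eq_Suc)
    then have "?P * (U * V + d * e - (U + V) * (d + e))
        = (if odd b then - (U ^ 4 * V ^ 2 * (U - V)) - U ^ 2 * V ^ 4 * (U - V)
            else - (U ^ 4 * V ^ 2 * (U - V)))"
      unfolding * by simp
    with True \<open>u \<noteq> v\<close> show ?thesis
      by (simp add: s_def U_def V_def lookup_minus lookup_var_powers_diff)
  next
    case False
    have *: "U * V + d * e - (U + V) * (d + e) = (if odd b then - (V ^ 2) else U * V)"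
      using False by (simp add: d_def e_def algebra_simps power2_eq_square)
    have "?P * (- (V ^ 2)) = - (U ^ 2 * V ^ 4 * (U - V))"
         "?P * (U * V) = U ^ 3 * V ^ 3 * (U - V)"
      by (simp_all add: algebra_simps numeral_eq_Suc)
    then have "?P * (U * V + d * e - (U + V) * (d + e))
        = (if odd b then - (U ^ 2 * V ^ 4 * (U - V)) else U ^ 3 * V ^ 3 * (U - V))"
      unfolding * by simp
    with False \<open>u \<noteq> v\<close> show ?thesis
      by (simp add: s_def U_def V_def lookup_minus lookup_var_powers_diff)
  qed
  finally show ?thesis .
qed

section \<open>The graph polynomial up to sign\<close>

text \<open>Changing the orientation of an edge negates a factor, so the graph polynomial is natural
  only up to sign, and the sign does not affect whether a coefficient vanishes.\<close>

definition eq_up_to_sign :: "'a::comm_ring_1 \<Rightarrow> 'a \<Rightarrow> bool"  (infix \<open>\<simeq>\<close> 50) where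
  "p \<simeq> q \<longleftrightarrow> p = q \<or> p = - q"

lemma eq_up_to_sign_mult: "p \<simeq> q \<Longrightarrow> p' \<simeq> q' \<Longrightarrow> p * p' \<simeq> q * q'"
  by (auto simp: eq_up_to_sign_def)

lemma eq_up_to_sign_prod: "(\<And>j. j \<in> J \<Longrightarrow> f j \<simeq> g j) \<Longrightarrow> prod f J \<simeq> prod g J"
proof (induction J rule: infinite_finite_induct)
  case (insert j J)
  then show ?case by (simp add: eq_up_to_sign_mult)
qed (auto simp: eq_up_to_sign_def)

lemma lookup_unit_eq_up_to_sign:
  fixes p q :: "('a, 'b::comm_ring_1) mpolynomial"
  assumes "p \<simeq> q" and "Poly_Mapping.lookup q m \<in> {1, - 1}"
  shows "Poly_Mapping.lookup p m \<in> {1, - 1}"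
  using assms by (auto simp: eq_up_to_sign_def)

lemma finite_darts:
  assumes "finite F" and "\<And>e. e \<in> F \<Longrightarrow> finite e"
  shows "finite {(x, y). {x, y} \<in> F \<and> lt x y}"
proof -
  have "{(x, y). {x, y} \<in> F \<and> lt x y} \<subseteq> \<Union>F \<times> \<Union>F" by auto
  moreover have "finite (\<Union>F \<times> \<Union>F)" using assms by auto
  ultimately show ?thesis by (rule finite_subset)
qed

lemma graph_poly_Un:
  assumes "finite A" "finite B" "\<And>e. e \<in> A \<union> B \<Longrightarrow> finite e" "A \<inter> B = {}"
  shows "graph_poly lt (A \<union> B) = graph_poly lt A * graph_poly lt B"
proof -
  have "{(x, y). {x, y} \<in> A \<union> B \<and> lt x y}
      = {(x, y). {x, y} \<in> A \<and> lt x y} \<union> {(x, y). {x, y} \<in> B \<and> lt x y}"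
    by auto
  moreover have "{(x, y). {x, y} \<in> A \<and> lt x y} \<inter> {(x, y). {x, y} \<in> B \<and> lt x y} = {}"
    using assms(4) by auto
  moreover have "finite {(x, y). {x, y} \<in> A \<and> lt x y}" "finite {(x, y). {x, y} \<in> B \<and> lt x y}"
    using assms(1-3) by (auto intro!: finite_darts)
  ultimately show ?thesis
    unfolding graph_poly_def by (simp only: prod.union_disjoint)
qed

text \<open>Precisely one of the two directions of the edge satisfies \<open>lt\<close>, and
  exchanging them negates the factor.\<close>

lemma graph_poly_edge:
  assumes "orientation {{x, y}} lt"
  shows "graph_poly lt {{x, y}} \<simeq> (var x - var y :: ('a, 'b::comm_ring_1) mpolynomial)"
proof (cases "lt x y")
  case True
  with assms have "{(a, b). {a, b} \<in> {{x, y}} \<and> lt a b} = {(x, y)}"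
    by (auto simp: orientation_def doubleton_eq_iff)
  then show ?thesis by (simp add: graph_poly_def eq_up_to_sign_def)
next
  case False
  with assms have "{(a, b). {a, b} \<in> {{x, y}} \<and> lt a b} = {(y, x)}"
    by (auto simp: orientation_def doubleton_eq_iff)
  then show ?thesis by (simp add: graph_poly_def eq_up_to_sign_def)
qed

lemma graph_poly_image:
  fixes f g :: "'i \<Rightarrow> 'a"
  assumes "finite J" and "inj_on (\<lambda>j. {f j, g j}) J" and "orientation ((\<lambda>j. {f j, g j}) ` J) lt"
  shows "graph_poly lt ((\<lambda>j. {f j, g j}) ` J)
    \<simeq> (\<Prod>j\<in>J. var (f j) - var (g j) :: ('a, 'b::comm_ring_1) mpolynomial)"
  using assms
proof (induction J rule: finite_induct)
  case empty
  then show ?case by (simp add: graph_poly_def eq_up_to_sign_def)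
next
  case (insert j J)
  let ?e = "\<lambda>j. {f j, g j}"
  have "graph_poly lt (?e ` insert j J) = (graph_poly lt ({?e j} \<union> ?e ` J) :: ('a, 'b) mpolynomial)"
    by simp
  also have "\<dots> = graph_poly lt {?e j} * graph_poly lt (?e ` J)"
    using insert.hyps insert.prems(1) by (intro graph_poly_Un) auto
  also have "\<dots> \<simeq> (var (f j) - var (g j)) * (\<Prod>j\<in>J. var (f j) - var (g j))"
    using insert.prems
    by (intro eq_up_to_sign_mult graph_poly_edge insert.IH) (auto simp: orientation_def)
  finally show ?case using insert.hyps by simp
qed

section \<open>The polynomial of the double wheel\<close>

text \<open>The four families are the hub edge, the spokes at \<open>u\<close>, the spokes at
  \<open>v\<close> and the rim. They are disjoint because the hubs are distinct and off the rim, and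
  each is indexed without repetition because \<open>w\<close> is injective, so every edge gives one
  factor.\<close>

lemma graph_poly_double_wheel:
  fixes w :: "nat \<Rightarrow> 'a" and u v :: 'a and I J K :: "nat set"
  assumes fin: "finite I" "finite J" "finite K"
    and inj: "inj_on w (I \<union> J \<union> K \<union> Suc ` K)"
    and "u \<noteq> v" "u \<notin> w ` (I \<union> J \<union> K \<union> Suc ` K)" "v \<notin> w ` (I \<union> J \<union> K \<union> Suc ` K)"
    and E: "E = {{u, v}} \<union> (\<lambda>j. {u, w j}) ` I \<union> (\<lambda>j. {v, w j}) ` J \<union> (\<lambda>j. {w j, w (Suc j)}) ` K"
    and "orientation E lt"
  shows "graph_poly lt E \<simeq> ((var u - var v) * (\<Prod>j\<in>I. var u - var (w j))
    * (\<Prod>j\<in>J. var v - var (w j)) * (\<Prod>j\<in>K. var (w j) - var (w (Suc j)))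
      :: ('a, 'b::comm_ring_1) mpolynomial)"
proof -
  have ori: "orientation F lt" if "F \<subseteq> E" for F
    using that assms(9) by (auto simp: orientation_def)
  let ?A = "(\<lambda>j. {u, w j}) ` I" and ?B = "(\<lambda>j. {v, w j}) ` J" and ?C = "(\<lambda>j. {w j, w (Suc j)}) ` K"
  have "inj_on (\<lambda>j. {u, w j}) I" "inj_on (\<lambda>j. {v, w j}) J"
    using inj by (auto simp: inj_on_def doubleton_eq_iff)
  moreover have "inj_on (\<lambda>j. {w j, w (Suc j)}) K"
  proof (rule inj_onI)
    fix j l assume jl: "j \<in> K" "l \<in> K" "{w j, w (Suc j)} = {w l, w (Suc l)}"
    from jl(3) consider "w j = w l" | "w j = w (Suc l)" "w (Suc j) = w l"
      by (auto simp: doubleton_eq_iff)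
    then show "j = l"
    proof cases
      case 1
      with inj jl show ?thesis by (auto dest: inj_onD)
    next
      case 2
      then have "j = Suc l" "Suc j = l"
        using jl(1,2) by (auto intro!: inj_onD[OF inj])
      then show ?thesis by simp
    qed
  qed
  ultimately have "graph_poly lt {{u, v}} * graph_poly lt ?A * graph_poly lt ?B * graph_poly lt ?C
    \<simeq> ((var u - var v) * (\<Prod>j\<in>I. var u - var (w j))
    * (\<Prod>j\<in>J. var v - var (w j)) * (\<Prod>j\<in>K. var (w j) - var (w (Suc j)))
      :: ('a, 'b) mpolynomial)"
    using fin by (intro eq_up_to_sign_mult graph_poly_edge graph_poly_image ori) (auto simp: E)
  moreover have "graph_poly lt E
    = (graph_poly lt {{u, v}} * graph_poly lt ?A * graph_poly lt ?B * graph_poly lt ?C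
      :: ('a, 'b) mpolynomial)"
  proof -
    have *: "{{u, v}} \<inter> ?A = {}" "({{u, v}} \<union> ?A) \<inter> ?B = {}" "({{u, v}} \<union> ?A \<union> ?B) \<inter> ?C = {}"
      using assms(5-7) by (auto simp: doubleton_eq_iff)
    have "graph_poly lt ({{u, v}} \<union> ?A) = (graph_poly lt {{u, v}} * graph_poly lt ?A :: ('a, 'b) mpolynomial)"
      by (rule graph_poly_Un[OF _ _ _ *(1)]) (use fin in auto)
    moreover have "graph_poly lt ({{u, v}} \<union> ?A \<union> ?B)
        = (graph_poly lt ({{u, v}} \<union> ?A) * graph_poly lt ?B :: ('a, 'b) mpolynomial)"
      by (rule graph_poly_Un[OF _ _ _ *(2)]) (use fin in auto)
    moreover have "graph_poly lt E
        = (graph_poly lt ({{u, v}} \<union> ?A \<union> ?B) * graph_poly lt ?C :: ('a, 'b) mpolynomial)"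
      unfolding E by (rule graph_poly_Un[OF _ _ _ *(3)]) (use fin in auto)
    ultimately show ?thesis by simp
  qed
  ultimately show ?thesis by simp
qed

lemma prod_diff_swap:
  "(\<Prod>j\<in>J. f j - g j) \<simeq> (\<Prod>j\<in>J. g j - f j)"
  by (rule eq_up_to_sign_prod) (auto simp: eq_up_to_sign_def)

text \<open>Setting \<open>w 1\<close>, \<open>w 2\<close> and \<open>w k\<close> to 0 turns their
  spokes into \<open>U ^ 2 * V ^ 2\<close> and the rim edges at \<open>w 2\<close> and
  \<open>w k\<close> into the variables of \<open>w 3\<close> and \<open>w (k - 1)\<close>, up to
  sign. The rest is a pair of fans meeting at \<open>w i\<close>.\<close>

lemma lookup_graph_poly_double_wheel:
  fixes w :: "nat \<Rightarrow> 'a" and k i :: nat and u v :: 'a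
  defines "U \<equiv> (var u :: ('a, 'b::comm_ring_1) mpolynomial)" and "V \<equiv> var v"
    and "X \<equiv> (\<lambda>j. var (w j))"
  assumes i: "3 \<le> i" "i < k" and inj: "inj_on w {1..k}" and "u \<noteq> v"
    and u: "u \<notin> w ` {1..k}" and v: "v \<notin> w ` {1..k}"
  shows "Poly_Mapping.lookup
      ((U - V) * (\<Prod>j=1..i. U - X j) * (\<Prod>j\<in>insert 1 {i..k}. V - X j) * (\<Prod>j=2..<k. X j - X (Suc j)))
      ((if even i then Poly_Mapping.single u 4 + Poly_Mapping.single v 3
        else Poly_Mapping.single u 3 + Poly_Mapping.single v 4)
       + (\<Sum>j=3..<k. Poly_Mapping.single (w j) 2)) \<in> {1, - 1}" (is "Poly_Mapping.lookup ?P ?m \<in> _")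
proof -
  \<comment> \<open>The numbers of rim edges from \<open>w 3\<close> and from
    \<open>w (k - 1)\<close> to \<open>w i\<close>; either may be 0.\<close>
  define a b where "a = i - 3" and "b = k - 1 - i"
  have ik: "i = a + 3" "k = a + b + 4"
    using i by (auto simp: a_def b_def)
  \<comment> \<open>Both paths end at \<open>w i\<close>: \<open>x\<close> climbs from
    \<open>w 3\<close> and \<open>y\<close> descends from \<open>w (k - 1)\<close>.\<close>
  define x y where "x = (\<lambda>j. w (3 + j))" and "y = (\<lambda>j. w (k - 1 - j))"
  define F where "F = var (x 0) * (\<Prod>j<a. (var (x j) - var (x (Suc j))) * (U - var (x j)))"
  define G where "G = var (y 0) * (\<Prod>j<b. (var (y j) - var (y (Suc j))) * (V - var (y j)))"
  define m0 where "m0 = (if odd a then Poly_Mapping.single u 4 + Poly_Mapping.single v 3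
        else Poly_Mapping.single u (3::nat) + Poly_Mapping.single v 4)"
  have ww: "w j = w l \<longleftrightarrow> j = l" if "1 \<le> j" "j \<le> k" "1 \<le> l" "l \<le> k" for j l
    using inj_on_eq_iff[OF inj, of j l] that by simp
  have wu: "w j \<noteq> u" "w j \<noteq> v" if "1 \<le> j" "j \<le> k" for j
    using u v that by auto
  let ?f = "\<lambda>j. Poly_Mapping.single (w j) (2::nat)"
  have m: "?m = m0 + Poly_Mapping.single (w i) 2 + (\<Sum>j<b. Poly_Mapping.single (y j) 2)
       + (\<Sum>j<a. Poly_Mapping.single (x j) 2)"
  proof -
    have e1: "(\<Sum>j<a. Poly_Mapping.single (x j) 2) = sum ?f {3..<i}"
      unfolding x_def ik by (rule sum.reindex_bij_witness[of _ "\<lambda>j. j - 3" "\<lambda>j. 3 + j"]) auto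
    have e2: "(\<Sum>j<b. Poly_Mapping.single (y j) 2) = sum ?f {Suc i..<k}"
      unfolding y_def ik
      by (rule sum.reindex_bij_witness[of _ "\<lambda>j. k - 1 - j" "\<lambda>j. k - 1 - j"]) (auto simp: ik)
    have e3: "sum ?f {3..<k} = sum ?f {3..<i} + (?f i + sum ?f {Suc i..<k})"
      using i sum.atLeastLessThan_concat[of 3 i k ?f] sum.atLeast_Suc_lessThan[of i k ?f] by simp
    \<comment> \<open>The parity switches because \<open>i\<close> and \<open>a\<close> differ by
      3.\<close>
    have "even i = odd a" by (simp add: ik)
    then show ?thesis
      unfolding e1 e2 e3 m0_def by (simp only: ac_simps)
  qed
  define R where "R = (U - V) * (\<Prod>j=3..i. U - X j) * (\<Prod>j=i..<k. V - X j) * (\<Prod>j=3..<k-1. X j - X (Suc j))"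
  have P: "?P = (U - X 1) * (V - X 1) * ((U - X 2) * (X 2 - X 3) * ((V - X k) * (X (k - 1) - X k) * R))"
  proof -
    have "(\<Prod>j=1..i. U - X j) = (U - X 1) * ((U - X 2) * (\<Prod>j=3..i. U - X j))"
      using i by (simp add: prod.atLeast_Suc_atMost numeral_eq_Suc)
    moreover have "(\<Prod>j\<in>insert 1 {i..k}. V - X j) = (V - X 1) * ((V - X k) * (\<Prod>j=i..<k. V - X j))"
    proof -
      have "insert 1 {i..k} = insert 1 (insert k {i..<k})" using i by auto
      then show ?thesis using i by simp
    qed
    moreover have "(\<Prod>j=2..<k. X j - X (Suc j))
        = (X 2 - X 3) * ((X (k - 1) - X k) * (\<Prod>j=3..<k-1. X j - X (Suc j)))"
    proof -
      have "{2..<k} = insert 2 (insert (k - 1) {3..<k-1})" using i by auto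
      then show ?thesis using i by simp
    qed
    ultimately show ?thesis by (simp add: R_def ac_simps)
  qed
  \<comment> \<open>The spokes \<open>U - X i\<close> and \<open>V - X i\<close> at the common end
    are split off; the other factors form the two fans.\<close>
  have R: "R * X 3 * X (k - 1) \<simeq> (U - V) * F * G * ((U - X i) * (V - X i))"
  proof -
    have "(\<Prod>j=3..i. U - X j) = (U - X i) * (\<Prod>j=3..<i. U - X j)"
      using i by (simp add: prod.last_plus)
    moreover have "(\<Prod>j=i..<k. V - X j) = (V - X i) * (\<Prod>j=Suc i..<k. V - X j)"
      using i by (simp add: prod.atLeast_Suc_lessThan)
    moreover have "(\<Prod>j=3..<k-1. X j - X (Suc j))
        = (\<Prod>j=3..<i. X j - X (Suc j)) * (\<Prod>j=i..<k-1. X j - X (Suc j))"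
      using i by (simp add: prod.atLeastLessThan_concat)
    ultimately have R': "R * X 3 * X (k - 1) = (U - V)
      * (X 3 * ((\<Prod>j=3..<i. X j - X (Suc j)) * (\<Prod>j=3..<i. U - X j)))
      * (X (k - 1) * ((\<Prod>j=i..<k-1. X j - X (Suc j)) * (\<Prod>j=Suc i..<k. V - X j)))
      * ((U - X i) * (V - X i))"
      by (simp add: R_def ac_simps)
    have "(\<Prod>j=3..<i. X j - X (Suc j)) = (\<Prod>j<a. var (x j) - var (x (Suc j)))"
      unfolding x_def X_def ik by (rule prod.reindex_bij_witness[of _ "\<lambda>j. 3 + j" "\<lambda>j. j - 3"]) auto
    moreover have "(\<Prod>j=3..<i. U - X j) = (\<Prod>j<a. U - var (x j))"
      unfolding x_def X_def ik by (rule prod.reindex_bij_witness[of _ "\<lambda>j. 3 + j" "\<lambda>j. j - 3"]) auto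
    ultimately have F: "X 3 * ((\<Prod>j=3..<i. X j - X (Suc j)) * (\<Prod>j=3..<i. U - X j)) = F"
      by (simp add: F_def prod.distrib) (simp add: x_def X_def)
    \<comment> \<open>The rim edge with lower end \<open>w (k - 2 - j)\<close> joins
      \<open>y (Suc j)\<close> to \<open>y j\<close>. Reading the path downwards therefore reverses
      every difference, which costs only a sign.\<close>
    have "(\<Prod>j=i..<k-1. X j - X (Suc j)) = (\<Prod>j<b. var (y (Suc j)) - var (y j))"
      unfolding y_def X_def
      by (rule prod.reindex_bij_witness[of _ "\<lambda>j. k - 2 - j" "\<lambda>j. k - 2 - j"])
        (auto simp: ik Suc_diff_Suc numeral_eq_Suc)
    also have "\<dots> \<simeq> (\<Prod>j<b. var (y j) - var (y (Suc j)))"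
      by (rule prod_diff_swap)
    finally have "(\<Prod>j=i..<k-1. X j - X (Suc j)) \<simeq> (\<Prod>j<b. var (y j) - var (y (Suc j)))" .
    moreover have "(\<Prod>j=Suc i..<k. V - X j) = (\<Prod>j<b. V - var (y j))"
      unfolding y_def X_def
      by (rule prod.reindex_bij_witness[of _ "\<lambda>j. k - 1 - j" "\<lambda>j. k - 1 - j"]) (auto simp: ik)
    moreover have "X (k - 1) = var (y 0)" by (simp add: X_def y_def)
    ultimately have G: "X (k - 1) * ((\<Prod>j=i..<k-1. X j - X (Suc j)) * (\<Prod>j=Suc i..<k. V - X j)) \<simeq> G"
      unfolding G_def prod.distrib by (auto simp: eq_up_to_sign_def)
    show ?thesis
      unfolding R' F by (intro eq_up_to_sign_mult G) (simp_all add: eq_up_to_sign_def)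
  qed
  have fR: "free_of (w j) R" if "j \<in> {1, 2, k}" for j
    unfolding R_def U_def V_def X_def
    using that i wu[of j]
    by (auto intro!: free_of_intros simp: ww)
  have m0: "Poly_Mapping.lookup ?m (w j) = 0" if "j \<in> {1, 2, k}" for j
    using that i wu[of j]
    by (auto simp: lookup_add lookup_single lookup_sum ww when_def intro!: sum.neutral)
  let ?Q = "(U - X 2) * (X 2 - X 3) * ((V - X k) * (X (k - 1) - X k) * R)"
  \<comment> \<open>The next three extractions set \<open>w 1\<close>, \<open>w 2\<close> and
    \<open>w k\<close> to 0 in turn; neither \<open>R\<close> nor the monomial contains
    them.\<close>
  have "Poly_Mapping.lookup ?P ?m = Poly_Mapping.lookup (U * V * ?Q) ?m"
    unfolding P
  proof (rule lookup_coefficient_0)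
    show "(U - X 1) * (V - X 1) * ?Q = U * V * ?Q + var (w 1) * (- ((U + V) * ?Q)) + var (w 1) ^ 2 * ?Q"
      unfolding X_def by (simp add: algebra_simps numeral_eq_Suc)
  qed (use i wu[of 1] fR[of 1] m0[of 1] in
      \<open>auto simp: U_def V_def X_def ww intro!: free_of_intros\<close>)
  also have "\<dots> = Poly_Mapping.lookup (U * V * (- (U * X 3) * ((V - X k) * (X (k - 1) - X k) * R))) ?m"
  proof (rule lookup_coefficient_0)
    let ?q = "U * V * ((V - X k) * (X (k - 1) - X k) * R)"
    show "U * V * ?Q = U * V * (- (U * X 3) * ((V - X k) * (X (k - 1) - X k) * R))
        + var (w 2) * ((U + X 3) * ?q) + var (w 2) ^ 2 * (- ?q)"
      unfolding X_def by (simp add: algebra_simps numeral_eq_Suc)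
  qed (use i wu[of 2] fR[of 2] m0[of 2] in
      \<open>auto simp: U_def V_def X_def ww intro!: free_of_intros\<close>)
  also have "\<dots> = Poly_Mapping.lookup (U * V * (- (U * X 3) * (V * X (k - 1) * R))) ?m"
  proof (rule lookup_coefficient_0)
    let ?q = "U * V * (- (U * X 3) * R)"
    show "U * V * (- (U * X 3) * ((V - X k) * (X (k - 1) - X k) * R))
        = U * V * (- (U * X 3) * (V * X (k - 1) * R))
        + var (w k) * (- (V + X (k - 1)) * ?q) + var (w k) ^ 2 * ?q"
      unfolding X_def by (simp add: algebra_simps numeral_eq_Suc)
  qed (use i wu[of k] fR[of k] m0[of k] in
      \<open>auto simp: U_def V_def X_def ww intro!: free_of_intros\<close>)
  also have "\<dots> = Poly_Mapping.lookup (- (U ^ 2 * V ^ 2) * (R * X 3 * X (k - 1))) ?m"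
    by (simp add: power2_eq_square ac_simps)
  finally have L: "Poly_Mapping.lookup ?P ?m
      = Poly_Mapping.lookup (- (U ^ 2 * V ^ 2) * (R * X 3 * X (k - 1))) ?m" .
  have "- (U ^ 2 * V ^ 2) * (R * X 3 * X (k - 1))
      \<simeq> U ^ 2 * V ^ 2 * ((U - V) * F * G * ((U - X i) * (V - X i)))"
    by (intro eq_up_to_sign_mult R) (simp add: eq_up_to_sign_def)
  then have "- (U ^ 2 * V ^ 2) * (R * X 3 * X (k - 1))
      \<simeq> U ^ 2 * V ^ 2 * (U - V) * F * G * ((U - X i) * (V - X i))"
    by (simp only: mult.assoc)
  moreover have "Poly_Mapping.lookup (U ^ 2 * V ^ 2 * (U - V) * F * G * ((U - X i) * (V - X i))) ?m \<in> {1, - 1}"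
    unfolding m m0_def U_def V_def X_def F_def G_def
  proof (rule lookup_double_fan[where x = x and y = y and a = a and b = b and z = "w i"])
    show "inj_on x {..a}" "inj_on y {..b}"
      by (auto simp: inj_on_def x_def y_def ww ik)
    show "x ` {..<a} \<inter> y ` {..b} = {}"
      by (auto simp: x_def y_def ww ik)
    have "x ` {..a} \<union> y ` {..b} \<subseteq> w ` {1..k}"
      by (auto simp: x_def y_def ik intro!: imageI)
    then show "u \<notin> x ` {..a} \<union> y ` {..b}" "v \<notin> x ` {..a} \<union> y ` {..b}"
      using u v by auto
  qed (use \<open>u \<noteq> v\<close> in \<open>auto simp: x_def y_def ik ac_simps\<close>)
  ultimately show ?thesis
    unfolding L by (rule lookup_unit_eq_up_to_sign)
qed

section \<open>Chords of the outer cycle\<close>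

text \<open>A path on \<open>x 0, ..., x n\<close>, indexed from 0 so that each part of the cycle
  can be read as a path starting at one end of a chord.\<close>

definition walk_edges :: "(nat \<Rightarrow> 'a) \<Rightarrow> nat \<Rightarrow> 'a set set" where
  "walk_edges x n = (\<lambda>j. {x j, x (Suc j)}) ` {..<n}"

lemma Union_walk_edges:
  assumes "0 < n"
  shows "\<Union>(walk_edges x n) = x ` {..n}"
proof
  show "x ` {..n} \<subseteq> \<Union>(walk_edges x n)"
  proof
    fix t assume "t \<in> x ` {..n}"
    then obtain j where j: "j \<le> n" "t = x j" by auto
    show "t \<in> \<Union>(walk_edges x n)"
    proof (cases "j < n")
      case True
      with j(2) show ?thesis by (auto simp: walk_edges_def)
    next
      case False
      with j assms have "t = x (Suc (n - 1))" "n - 1 < n" by auto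
      then show ?thesis unfolding walk_edges_def by blast
    qed
  qed
qed (auto simp: walk_edges_def)

text \<open>Only the first edge contains \<open>x 0\<close> and only the last contains
  \<open>x n\<close>; with at least two edges these differ.\<close>

lemma ends_notin_walk_edges:
  assumes "inj_on x {..n}" "2 \<le> n"
  shows "{x 0, x n} \<notin> walk_edges x n"
proof
  assume "{x 0, x n} \<in> walk_edges x n"
  then obtain j where j: "j < n" "{x 0, x n} = {x j, x (Suc j)}"
    by (auto simp: walk_edges_def)
  then have "x 0 = x j \<and> x n = x (Suc j) \<or> x 0 = x (Suc j)"
    by (auto simp: doubleton_eq_iff)
  with j(1) assms(2) show False
    by (simp add: inj_on_eq_iff[OF assms(1)])
qed

lemma edge_points_Un: "edge_points \<gamma> (A \<union> B) = edge_points \<gamma> A \<union> edge_points \<gamma> B"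
  by (auto simp: edge_points_def)

lemma edge_points_singleton: "edge_points \<gamma> {e} = path_image (\<gamma> e)"
  by (simp add: edge_points_def)

section \<open>Arcs and regions in the drawing\<close>

context plane_graph
begin

lemma finite_E: "finite E"
  by (rule finite_subset[of _ "Pow V"]) (use finite_V edge_subset in auto)

lemma edge_vertices:
  assumes "{a, b} \<in> E"
  shows "a \<in> V" "b \<in> V" "a \<noteq> b" "pos a \<noteq> pos b"
proof -
  show "a \<in> V" "b \<in> V" using edge_subset[OF assms] by auto
  show "a \<noteq> b" using edge_card[OF assms] by auto
  with \<open>a \<in> V\<close> \<open>b \<in> V\<close> show "pos a \<noteq> pos b"
    using inj_pos by (auto dest: inj_onD)
qed

lemma pos_in_edge: "e \<in> E \<Longrightarrow> a \<in> e \<Longrightarrow> pos a \<in> path_image (\<gamma> e)"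
  using edge_ends[of e] pathstart_in_path_image[of "\<gamma> e"] pathfinish_in_path_image[of "\<gamma> e"]
  by (metis imageI insertE singletonD)

lemma vertex_on_edge:
  assumes "e \<in> E" "a \<in> V" "pos a \<in> path_image (\<gamma> e)"
  shows "a \<in> e"
proof -
  have "pos a \<in> pos ` e"
    using interior_vertices[OF assms(1)] assms by auto
  then show ?thesis
    using inj_pos assms edge_subset[OF assms(1)] by (auto dest: inj_onD)
qed

lemma vertex_on_edge_points:
  assumes "F \<subseteq> E" "a \<in> V" "pos a \<in> edge_points \<gamma> F"
  shows "a \<in> \<Union>F"
  using assms vertex_on_edge by (fastforce simp: edge_points_def)

text \<open>A common point is interior to neither edge, hence an end of both, and injectivity of
  \<open>pos\<close> makes it the position of a common vertex.\<close>

lemma edges_Int: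
  assumes "e \<in> E" "f \<in> E" "e \<noteq> f"
  shows "path_image (\<gamma> e) \<inter> path_image (\<gamma> f) \<subseteq> pos ` (e \<inter> f)"
proof
  fix p assume p: "p \<in> path_image (\<gamma> e) \<inter> path_image (\<gamma> f)"
  then have "p \<in> pos ` e" "p \<in> pos ` f"
    using interior_edges[of e f] interior_edges[of f e] assms by auto
  then show "p \<in> pos ` (e \<inter> f)"
    using inj_on_image_Int[OF inj_pos edge_subset edge_subset] assms by blast
qed

text \<open>The drawing gives the ends of \<open>\<gamma> {a, b}\<close> only as an unordered pair,
  so the arc may have to be reversed.\<close>

lemma edge_arc:
  assumes "{a, b} \<in> E"
  obtains g where "arc g" "pathstart g = pos a" "pathfinish g = pos b"
    "path_image g = path_image (\<gamma> {a, b})"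
proof -
  have "{pathstart (\<gamma> {a, b}), pathfinish (\<gamma> {a, b})} = {pos a, pos b}"
    using edge_ends[OF assms] by simp
  then consider "pathstart (\<gamma> {a, b}) = pos a" "pathfinish (\<gamma> {a, b}) = pos b"
    | "pathstart (\<gamma> {a, b}) = pos b" "pathfinish (\<gamma> {a, b}) = pos a"
    by (auto simp: doubleton_eq_iff)
  then show ?thesis
  proof cases
    case 1
    then show ?thesis using that arc_edge[OF assms] by blast
  next
    case 2
    then show ?thesis
      using that[of "reversepath (\<gamma> {a, b})"] arc_edge[OF assms] by (simp add: arc_reversepath)
  qed
qed

text \<open>The arcs of the edges are joined one after another. The length is written
  \<open>Suc n\<close> because an arc needs at least one edge.\<close>

lemma walk_arc:
  assumes "inj_on x {..Suc n}" and "walk_edges x (Suc n) \<subseteq> E"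
  shows "\<exists>g. arc g \<and> pathstart g = pos (x 0) \<and> pathfinish g = pos (x (Suc n))
    \<and> path_image g = edge_points \<gamma> (walk_edges x (Suc n))"
  using assms
proof (induction n)
  case 0
  then have "{x 0, x 1} \<in> E" by (auto simp: walk_edges_def)
  then show ?case
    by (rule edge_arc) (auto simp: walk_edges_def edge_points_def)
next
  case (Suc n)
  let ?e = "{x (Suc n), x (Suc (Suc n))}"
  have we: "walk_edges x (Suc (Suc n)) = walk_edges x (Suc n) \<union> {?e}"
    unfolding walk_edges_def lessThan_Suc[of "Suc n"] by simp
  have "inj_on x {..Suc n}"
    using Suc.prems(1) by (rule inj_on_subset) auto
  then obtain g where g: "arc g" "pathstart g = pos (x 0)" "pathfinish g = pos (x (Suc n))"
      "path_image g = edge_points \<gamma> (walk_edges x (Suc n))"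
    using Suc.IH Suc.prems(2) we by auto
  have e: "?e \<in> E" using Suc.prems(2) we by auto
  then obtain h where h: "arc h" "pathstart h = pos (x (Suc n))" "pathfinish h = pos (x (Suc (Suc n)))"
      "path_image h = path_image (\<gamma> ?e)"
    by (rule edge_arc)
  \<comment> \<open>The new edge meets an earlier one only in a common vertex, which on a path
    without repetition can only be \<open>x (Suc n)\<close>.\<close>
  have "path_image g \<inter> path_image h \<subseteq> {pathstart h}"
  proof
    fix p assume p: "p \<in> path_image g \<inter> path_image h"
    then obtain j where j: "j \<le> n" "p \<in> path_image (\<gamma> {x j, x (Suc j)})"
      by (auto simp: g(4) edge_points_def walk_edges_def less_Suc_eq_le)
    have ne: "x l \<noteq> x l'" if "l < l'" "l' \<le> Suc (Suc n)" for l l'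
      using Suc.prems(1) that by (auto dest!: inj_onD)
    have "{x j, x (Suc j)} \<in> E"
      using j(1) Suc.prems(2) by (auto simp: walk_edges_def)
    moreover have "{x j, x (Suc j)} \<inter> ?e \<subseteq> {x (Suc n)}"
      using ne[of j "Suc (Suc n)"] ne[of "Suc j" "Suc (Suc n)"] j(1) by (cases "j = n") auto
    moreover have "x j \<notin> ?e"
      using ne[of j "Suc (Suc n)"] ne[of j "Suc n"] j(1) by auto
    then have "{x j, x (Suc j)} \<noteq> ?e" by blast
    ultimately have "p \<in> pos ` {x (Suc n)}"
      using edges_Int[of "{x j, x (Suc j)}" ?e] e p j(2) h(4) by blast
    then show "p \<in> {pathstart h}" by (simp add: h(2))
  qed
  then have "arc (g +++ h)" using g h by (intro arc_join) auto
  moreover have "path_image (g +++ h) = edge_points \<gamma> (walk_edges x (Suc (Suc n)))"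
    unfolding we edge_points_Un edge_points_singleton using g h by (simp add: path_image_join)
  ultimately show ?case using g h by (intro exI[of _ "g +++ h"]) auto
qed

text \<open>Edges meet only in common vertices and neither end of \<open>{a, b}\<close> lies on the
  drawing of \<open>F\<close>, so this edge misses that drawing. Being connected, it stays in the
  component of \<open>pos a\<close>.\<close>

lemma neighbour_inside:
  assumes "F \<subseteq> E" and "{a, b} \<in> E" and "pos a \<in> inside (edge_points \<gamma> F)"
    and "pos b \<notin> edge_points \<gamma> F"
  shows "pos b \<in> inside (edge_points \<gamma> F)"
proof -
  have a: "pos a \<notin> edge_points \<gamma> F"
    using assms(3) inside_no_overlap by blast
  have "path_image (\<gamma> {a, b}) \<inter> path_image (\<gamma> f) = {}" if "f \<in> F" for f
  proof -
    have "f \<in> E" using that assms(1) by auto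
    have "a \<notin> f" "b \<notin> f"
      using a assms(4) that pos_in_edge[OF \<open>f \<in> E\<close>] by (auto simp: edge_points_def)
    then show ?thesis
      using edges_Int[OF assms(2) \<open>f \<in> E\<close>] by auto
  qed
  then have "path_image (\<gamma> {a, b}) \<subseteq> - edge_points \<gamma> F"
    by (auto simp: edge_points_def)
  moreover have "connected (path_image (\<gamma> {a, b}))"
    using arc_edge[OF assms(2)] by (simp add: arc_imp_path connected_path_image)
  moreover have "pos a \<in> path_image (\<gamma> {a, b})" "pos b \<in> path_image (\<gamma> {a, b})"
    using pos_in_edge[OF assms(2)] by auto
  ultimately have "connected_component (- edge_points \<gamma> F) (pos a) (pos b)"
    by (auto simp: connected_component_def)
  then show ?thesis
    using assms(3) by (rule inside_same_component)
qed

lemma compact_edge_points: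
  assumes "F \<subseteq> E"
  shows "compact (edge_points \<gamma> F)"
  unfolding edge_points_def
  using assms finite_subset[OF assms finite_E] arc_edge
  by (intro compact_UN) (auto intro: compact_path_image arc_imp_path)

text \<open>The exterior of the boundary is connected, meets the outer face and misses its frontier, so it
  lies in the outer face.\<close>

lemma edge_not_outside_boundary:
  assumes "F \<subseteq> E" and "frontier (outer_face V E pos \<gamma>) = edge_points \<gamma> F" and "e \<in> E"
  shows "path_image (\<gamma> e) \<inter> outside (edge_points \<gamma> F) = {}"
proof -
  let ?C = "edge_points \<gamma> F" and ?D = "pos ` V \<union> edge_points \<gamma> E"
  have "bounded ?D"
    using compact_imp_bounded[OF compact_edge_points[of E]] finite_V by (auto intro: finite_imp_bounded)
  then have "outside ?D \<noteq> {}" by (rule outside_bounded_nonempty)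
  moreover have "outside ?D \<subseteq> outside ?C"
    using assms(1) by (intro outside_mono) (auto simp: edge_points_def)
  moreover have "connected (outside ?C)"
    using compact_imp_bounded[OF compact_edge_points[OF assms(1)]]
    by (intro connected_outside) auto
  moreover have "outside ?C \<inter> frontier (outside ?D) = {}"
    using assms(2) by (simp add: outer_face_def outside_no_overlap)
  ultimately have "outside ?C \<subseteq> outside ?D"
    using connected_Int_frontier[of "outside ?C" "outside ?D"] by blast
  moreover have "path_image (\<gamma> e) \<subseteq> ?D"
    using assms(3) by (auto simp: edge_points_def)
  ultimately show ?thesis
    using outside_no_overlap[of ?D] by blast
qed

text \<open>An arc is injective, so its point at parameter 1/2 is neither end.\<close>

lemma edge_interior_point:
  assumes "e \<in> E"
  obtains z where "z \<in> path_image (\<gamma> e) - pos ` e"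
proof -
  have inj: "inj_on (\<gamma> e) {0..1}" using arc_edge[OF assms] by (simp add: arc_def)
  have "\<gamma> e (1/2) \<noteq> \<gamma> e 0" "\<gamma> e (1/2) \<noteq> \<gamma> e 1"
    using inj_onD[OF inj, of "1/2" 0] inj_onD[OF inj, of "1/2" 1] by auto
  moreover have "pos ` e = {\<gamma> e 0, \<gamma> e 1}"
    using edge_ends[OF assms] by (simp add: pathstart_def pathfinish_def)
  moreover have "\<gamma> e (1/2) \<in> path_image (\<gamma> e)" by (simp add: path_image_def)
  ultimately show ?thesis using that by blast
qed

section \<open>Excluding chords\<close>

text \<open>In the application \<open>F\<close> bounds the side of a theta curve that contains
  \<open>u\<close>, and \<open>F'\<close> is the cycle. The adjacent vertex \<open>v\<close> is on
  the same side, so a neighbour of \<open>u\<close> or \<open>v\<close> lies on \<open>F\<close> or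
  inside it. A vertex of \<open>F'\<close> cannot be inside \<open>F\<close>, since that region lies
  inside \<open>F'\<close>.\<close>

lemma theta_side:
  assumes "F \<subseteq> E" "F' \<subseteq> E" and "inside (edge_points \<gamma> F) \<subseteq> inside (edge_points \<gamma> F')"
    and u: "pos u \<in> inside (edge_points \<gamma> F)" and "{u, v} \<in> E" and "pos v \<notin> edge_points \<gamma> F"
    and "a \<in> neighbourhood E u \<union> neighbourhood E v" and "a \<in> \<Union>F'"
  shows "a \<in> \<Union>F"
proof (rule ccontr)
  assume a: "a \<notin> \<Union>F"
  have v: "pos v \<in> inside (edge_points \<gamma> F)"
    using neighbour_inside assms by blast
  from assms(7) consider "{u, a} \<in> E" | "{v, a} \<in> E" by (auto simp: neighbourhood_def)
  then have "pos a \<in> inside (edge_points \<gamma> F)"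
  proof cases
    case 1
    then show ?thesis
      using neighbour_inside[OF assms(1) 1 u] vertex_on_edge_points[OF assms(1), of a] edge_vertices a by blast
  next
    case 2
    then show ?thesis
      using neighbour_inside[OF assms(1) 2 v] vertex_on_edge_points[OF assms(1), of a] edge_vertices a by blast
  qed
  moreover have "pos a \<in> edge_points \<gamma> F'"
    using assms(2,8) pos_in_edge by (fastforce simp: edge_points_def)
  ultimately show False
    using assms(3) inside_no_overlap by blast
qed

text \<open>The paths \<open>x\<close> and \<open>y\<close> make up the cycle, and a chord would
  complete them to a theta curve. The path that does not bound the region of \<open>u\<close> has an
  inner vertex, which then could be adjacent to neither \<open>u\<close> nor
  \<open>v\<close>.\<close>

lemma no_chord:
  assumes x: "inj_on x {..n}" "walk_edges x n \<subseteq> E" "2 \<le> n"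
    and y: "inj_on y {..m}" "walk_edges y m \<subseteq> E" "2 \<le> m"
    and ends: "x 0 = a" "y 0 = a" "x n = b" "y m = b"
    and disj: "x ` {..n} \<inter> y ` {..m} = {a, b}"
  defines "C \<equiv> edge_points \<gamma> (walk_edges x n \<union> walk_edges y m)"
  assumes outer: "frontier (outer_face V E pos \<gamma>) = C"
    and u: "pos u \<in> inside C" and v: "pos v \<in> inside C" and "{u, v} \<in> E"
    and nb: "x ` {..n} \<union> y ` {..m} \<subseteq> neighbourhood E u \<union> neighbourhood E v"
  shows "{a, b} \<notin> E"
proof
  assume E: "{a, b} \<in> E"
  let ?X = "walk_edges x n" and ?Y = "walk_edges y m" and ?c = "{{a, b}}"
  have UX: "\<Union>?X = x ` {..n}" and UY: "\<Union>?Y = y ` {..m}"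
    using x(3) y(3) by (simp_all add: Union_walk_edges)
  have ab: "a \<noteq> b" "pos a \<noteq> pos b" "a \<in> V" "b \<in> V" using edge_vertices[OF E] by auto
  have nX: "{a, b} \<notin> ?X" and nY: "{a, b} \<notin> ?Y"
    using ends_notin_walk_edges[OF x(1,3)] ends_notin_walk_edges[OF y(1,3)] by (simp_all add: ends)
  obtain c where c: "arc c" "pathstart c = pos a" "pathfinish c = pos b"
      "path_image c = edge_points \<gamma> ?c"
    by (rule edge_arc[OF E]) (simp add: edge_points_singleton)
  obtain g where g: "arc g" "pathstart g = pos a" "pathfinish g = pos b"
      "path_image g = edge_points \<gamma> ?X"
    using walk_arc[of x "n - 1"] x ends by auto
  obtain h where h: "arc h" "pathstart h = pos a" "pathfinish h = pos b"
      "path_image h = edge_points \<gamma> ?Y"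
    using walk_arc[of y "m - 1"] y ends by auto
  \<comment> \<open>This serves each pair among the two paths and the chord.\<close>
  have Int: "edge_points \<gamma> F \<inter> edge_points \<gamma> F' \<subseteq> {pos a, pos b}"
    if "F \<subseteq> E" "F' \<subseteq> E" "\<And>e f. e \<in> F \<Longrightarrow> f \<in> F' \<Longrightarrow> e \<noteq> f \<and> e \<inter> f \<subseteq> {a, b}" for F F'
  proof -
    have "path_image (\<gamma> e) \<inter> path_image (\<gamma> f) \<subseteq> {pos a, pos b}" if "e \<in> F" "f \<in> F'" for e f
      using edges_Int[of e f] \<open>F \<subseteq> E\<close> \<open>F' \<subseteq> E\<close> that \<open>\<And>e f. e \<in> F \<Longrightarrow> f \<in> F' \<Longrightarrow> e \<noteq> f \<and> e \<inter> f \<subseteq> {a, b}\<close>[of e f]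
      by blast
    then show ?thesis by (auto simp: edge_points_def)
  qed
  have XY: "e \<noteq> f \<and> e \<inter> f \<subseteq> {a, b}" if "e \<in> ?X" "f \<in> ?Y" for e f
  proof
    have "e \<subseteq> x ` {..n}" "f \<subseteq> y ` {..m}" using that UX UY by auto
    then show *: "e \<inter> f \<subseteq> {a, b}" using disj by blast
    \<comment> \<open>A common edge would lie in \<open>{a, b}\<close> and so be the chord, which is
      not on the path \<open>x\<close>.\<close>
    show "e \<noteq> f"
    proof
      assume "e = f"
      then have "e \<subseteq> {a, b}" using * by auto
      moreover have "card e = 2" using edge_card that(1) x(2) by auto
      ultimately have "e = {a, b}" using ab(1) by (intro card_subset_eq) auto
      with nX that show False by simp
    qed
  qed
  have sub: "pos a \<in> path_image p" "pos b \<in> path_image p" if "pathstart p = pos a" "pathfinish p = pos b" for p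
    using that pathstart_in_path_image[of p] pathfinish_in_path_image[of p] by auto
  have Int_gh: "path_image g \<inter> path_image h = {pos a, pos b}"
    using Int[OF x(2) y(2) XY] sub[OF g(2,3)] sub[OF h(2,3)] g(4) h(4) by blast
  have "edge_points \<gamma> ?X \<inter> edge_points \<gamma> ?c \<subseteq> {pos a, pos b}"
    by (rule Int) (use x(2) E nX in auto)
  then have Int_gc: "path_image g \<inter> path_image c = {pos a, pos b}"
    using sub[OF g(2,3)] sub[OF c(2,3)] g(4) c(4) by blast
  have "edge_points \<gamma> ?Y \<inter> edge_points \<gamma> ?c \<subseteq> {pos a, pos b}"
    by (rule Int) (use y(2) E nY in auto)
  then have Int_hc: "path_image h \<inter> path_image c = {pos a, pos b}"
    using sub[OF h(2,3)] sub[OF c(2,3)] h(4) c(4) by blast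
  have C: "C = path_image g \<union> path_image h"
    by (simp add: C_def edge_points_Un g h)
  \<comment> \<open>One interior point shows that the chord enters the inside of the cycle: it is on
    neither path, and no edge reaches the outside.\<close>
  obtain z where z: "z \<in> path_image c - {pos a, pos b}"
    using edge_interior_point[OF E] c(4) by (auto simp: edge_points_singleton)
  then have "z \<notin> C"
    using Int_gc Int_hc unfolding C by blast
  moreover have "z \<notin> outside C"
    using edge_not_outside_boundary[of "?X \<union> ?Y", OF _ _ E] outer x(2) y(2) z c(4)
    unfolding C_def by (auto simp: edge_points_singleton)
  ultimately have "z \<in> inside C"
    using inside_Un_outside[of C] by blast
  with z have "path_image c \<inter> inside (path_image g \<union> path_image h) \<noteq> {}"
    unfolding C by blast
  \<comment> \<open>The theta-curve theorem: the chord divides the inside of the cycle into the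
    insides of the two smaller closed curves.\<close>
  then have split: "inside (edge_points \<gamma> (?X \<union> ?c)) \<union> inside (edge_points \<gamma> (?Y \<union> ?c))
      \<union> (path_image c - {pos a, pos b}) = inside C"
    unfolding edge_points_Un c(4)[symmetric] g(4)[symmetric] h(4)[symmetric] C
    by (rule split_inside_simple_closed_curve[OF arc_imp_simple_path[OF g(1)] g(2,3)
          arc_imp_simple_path[OF h(1)] h(2,3) arc_imp_simple_path[OF c(1)] c(2,3) ab(2)
          Int_gh Int_gc Int_hc])
  \<comment> \<open>The only vertices on the chord are \<open>a\<close> and \<open>b\<close>, which
    lie on the cycle and hence not inside it.\<close>
  have not_on: "pos t \<notin> path_image c" if "pos t \<in> inside C" "t \<in> V" for t
  proof
    assume "pos t \<in> path_image c"
    then have "t \<in> {a, b}"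
      using vertex_on_edge[OF E that(2)] c(4) by (simp add: edge_points_singleton)
    then have "pos t \<in> C" using Int_gh unfolding C by blast
    with that(1) show False using inside_no_overlap by blast
  qed
  have uvV: "u \<in> V" "v \<in> V" using edge_vertices[OF \<open>{u, v} \<in> E\<close>] by auto
  have vC: "pos v \<notin> C" using v inside_no_overlap by blast
  \<comment> \<open>Both paths have at least two edges, so \<open>x 1\<close> and \<open>y 1\<close>
    are inner vertices; the one on the path away from \<open>u\<close> gives the
    contradiction.\<close>
  have x1: "x 1 \<notin> y ` {..m}" and y1: "y 1 \<notin> x ` {..n}"
  proof -
    have "x 1 \<noteq> x 0" "x 1 \<noteq> x n" using x(3) by (simp_all add: inj_on_eq_iff[OF x(1)])
    then have "x 1 \<notin> {a, b}" by (simp add: ends)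
    moreover have "x 1 \<in> x ` {..n}" using x(3) by auto
    ultimately show "x 1 \<notin> y ` {..m}" using disj by blast
    have "y 1 \<noteq> y 0" "y 1 \<noteq> y m" using y(3) by (simp_all add: inj_on_eq_iff[OF y(1)])
    then have "y 1 \<notin> {a, b}" by (simp add: ends)
    moreover have "y 1 \<in> y ` {..m}" using y(3) by auto
    ultimately show "y 1 \<notin> x ` {..n}" using disj by blast
  qed
  have XYE: "?X \<union> ?Y \<subseteq> E" "?X \<union> ?c \<subseteq> E" "?Y \<union> ?c \<subseteq> E" using x(2) y(2) E by auto
  have in_ab: "{a, b} \<subseteq> x ` {..n}" "{a, b} \<subseteq> y ` {..m}" using disj by auto
  from split u not_on[OF u uvV(1)] consider
      "pos u \<in> inside (edge_points \<gamma> (?X \<union> ?c))" | "pos u \<in> inside (edge_points \<gamma> (?Y \<union> ?c))"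
    by blast
  then show False
  proof cases
    case 1
    have "y 1 \<in> \<Union>(?X \<union> ?c)"
    proof (rule theta_side[OF XYE(2,1) _ 1 \<open>{u, v} \<in> E\<close>])
      show "inside (edge_points \<gamma> (?X \<union> ?c)) \<subseteq> inside (edge_points \<gamma> (?X \<union> ?Y))"
        unfolding C_def[symmetric] using split by blast
      show "pos v \<notin> edge_points \<gamma> (?X \<union> ?c)"
        unfolding edge_points_Un c(4)[symmetric] g(4)[symmetric]
        using vC not_on[OF v uvV(2)] by (simp add: C)
      have "y 1 \<in> y ` {..m}" using y(3) by auto
      then show "y 1 \<in> neighbourhood E u \<union> neighbourhood E v" "y 1 \<in> \<Union>(?X \<union> ?Y)"
        using nb by (blast, simp add: UY)
    qed
    then show False using y1 UX in_ab by auto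
  next
    case 2
    have "x 1 \<in> \<Union>(?Y \<union> ?c)"
    proof (rule theta_side[OF XYE(3,1) _ 2 \<open>{u, v} \<in> E\<close>])
      show "inside (edge_points \<gamma> (?Y \<union> ?c)) \<subseteq> inside (edge_points \<gamma> (?X \<union> ?Y))"
        unfolding C_def[symmetric] using split by blast
      show "pos v \<notin> edge_points \<gamma> (?Y \<union> ?c)"
        unfolding edge_points_Un c(4)[symmetric] h(4)[symmetric]
        using vC not_on[OF v uvV(2)] by (simp add: C)
      have "x 1 \<in> x ` {..n}" using x(3) by auto
      then show "x 1 \<in> neighbourhood E u \<union> neighbourhood E v" "x 1 \<in> \<Union>(?X \<union> ?Y)"
        using nb by (blast, simp add: UX)
    qed
    then show False using x1 UY in_ab by auto
  qed
qed

text \<open>Two vertices that are not consecutive cut the cycle into two paths of at least two edges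
  each, and \<open>no_chord\<close> applies to these.\<close>

lemma chord_in_cycle_edges:
  assumes cyc: "is_cycle E w k"
    and outer: "frontier (outer_face V E pos \<gamma>) = edge_points \<gamma> (cycle_edges w k)"
    and u: "pos u \<in> inside (edge_points \<gamma> (cycle_edges w k))"
    and v: "pos v \<in> inside (edge_points \<gamma> (cycle_edges w k))"
    and "{u, v} \<in> E" and nb: "w ` {1..k} \<subseteq> neighbourhood E u \<union> neighbourhood E v"
    and pq: "1 \<le> p" "p < q" "q \<le> k" and E: "{w p, w q} \<in> E"
  shows "q = Suc p \<or> p = 1 \<and> q = k"
proof (rule ccontr)
  assume "\<not> (q = Suc p \<or> p = 1 \<and> q = k)"
  then have not_cyc: "q \<noteq> Suc p" "p \<noteq> 1 \<or> q \<noteq> k" by auto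
  have inj: "inj_on w {1..k}" and cE: "cycle_edges w k \<subseteq> E"
    using cyc by (auto simp: is_cycle_def)
  \<comment> \<open>The first path climbs from \<open>p\<close> to \<open>q\<close> in
    \<open>n\<close> steps. The second follows \<open>r\<close>: it descends from \<open>p\<close>
    to 1, jumps to \<open>k\<close> at \<open>j = p\<close> and descends to \<open>q\<close>, in
    \<open>m\<close> steps altogether.\<close>
  define n m where "n = q - p" and "m = p + k - q"
  define r where "r j = (if j < p then p - j else k + p - j)" for j
  let ?x = "\<lambda>j. w (p + j)" and ?y = "\<lambda>j. w (r j)"
  have rng: "(\<lambda>j. p + j) ` {..n} = {p..q}" "r ` {..m} = {1..p} \<union> {q..k}"
  proof -
    show "(\<lambda>j. p + j) ` {..n} = {p..q}"
      using pq by (simp add: n_def atMost_atLeast0)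
    show "r ` {..m} = {1..p} \<union> {q..k}"
    proof
      show "r ` {..m} \<subseteq> {1..p} \<union> {q..k}"
        using pq by (auto simp: r_def m_def)
      show "{1..p} \<union> {q..k} \<subseteq> r ` {..m}"
      proof
        fix t assume t: "t \<in> {1..p} \<union> {q..k}"
        show "t \<in> r ` {..m}"
          by (rule image_eqI[of _ _ "if t \<le> p then p - t else k + p - t"])
            (use t pq in \<open>auto simp: r_def m_def\<close>)
      qed
    qed
  qed
  have edges: "walk_edges ?x n \<union> walk_edges ?y m = cycle_edges w k"
  proof
    show "walk_edges ?x n \<union> walk_edges ?y m \<subseteq> cycle_edges w k"
    proof
      fix e assume "e \<in> walk_edges ?x n \<union> walk_edges ?y m"
      then consider j where "j < n" "e = {w (p + j), w (p + j + 1)}"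
        | j where "j < m" "e = {w (r j), w (r (Suc j))}"
        by (auto simp: walk_edges_def)
      then show "e \<in> cycle_edges w k"
      proof cases
        case (1 j)
        then have "1 \<le> p + j" "p + j < k" using pq by (auto simp: n_def)
        with 1 show ?thesis unfolding cycle_edges_def by blast
      next
        case (2 j)
        consider "Suc j < p" | "Suc j = p" | "p \<le> j" by linarith
        then show ?thesis
        proof cases
          case 1
          then have "r j = r (Suc j) + 1" "1 \<le> r (Suc j)" "r (Suc j) < k" using pq by (auto simp: r_def)
          with 2 show ?thesis unfolding cycle_edges_def by (auto simp: insert_commute)
        next
          \<comment> \<open>The jump of \<open>r\<close> from 1 to \<open>k\<close> uses the closing
            edge of the cycle.\<close>
          case b: 2
          then have "r j = 1" "r (Suc j) = k" using pq by (auto simp: r_def)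
          with 2 show ?thesis unfolding cycle_edges_def by (auto simp: insert_commute)
        next
          case 3
          then have "r j = r (Suc j) + 1" "1 \<le> r (Suc j)" "r (Suc j) < k"
            using pq 2(1) by (auto simp: r_def m_def)
          with 2 show ?thesis unfolding cycle_edges_def by (auto simp: insert_commute)
        qed
      qed
    qed
    show "cycle_edges w k \<subseteq> walk_edges ?x n \<union> walk_edges ?y m"
    proof
      fix e assume "e \<in> cycle_edges w k"
      then consider "e = {w k, w 1}" | j where "1 \<le> j" "j < k" "e = {w j, w (j + 1)}"
        by (auto simp: cycle_edges_def)
      then show "e \<in> walk_edges ?x n \<union> walk_edges ?y m"
      proof cases
        case 1
        have "p - 1 < m" "r (p - 1) = 1" "r (Suc (p - 1)) = k" using pq by (auto simp: r_def m_def)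
        with 1 have "e \<in> walk_edges ?y m"
          unfolding walk_edges_def by (intro image_eqI[of _ _ "p - 1"]) (auto simp: insert_commute)
        then show ?thesis by simp
      next
        case (2 j)
        consider "j < p" | "p \<le> j" "j < q" | "q \<le> j" by linarith
        then show ?thesis
        proof cases
          case 1
          then have "p - 1 - j < m" "r (p - 1 - j) = j + 1" "r (Suc (p - 1 - j)) = j"
            using pq 2 by (auto simp: r_def m_def)
          with 2 have "e \<in> walk_edges ?y m"
            unfolding walk_edges_def by (intro image_eqI[of _ _ "p - 1 - j"]) (auto simp: insert_commute)
          then show ?thesis by simp
        next
          case b: 2
          with 2 have "e \<in> walk_edges ?x n"
            unfolding walk_edges_def n_def by (intro image_eqI[of _ _ "j - p"]) auto
          then show ?thesis by simp
        next
          case 3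
          then have "k + p - j - 1 < m" "r (k + p - j - 1) = j + 1" "r (Suc (k + p - j - 1)) = j"
            using pq 2 by (auto simp: r_def m_def)
          with 2 have "e \<in> walk_edges ?y m"
            unfolding walk_edges_def by (intro image_eqI[of _ _ "k + p - j - 1"]) (auto simp: insert_commute)
          then show ?thesis by simp
        qed
      qed
    qed
  qed
  have "inj_on r {..m}"
  proof (rule inj_onI)
    fix j l assume "j \<in> {..m}" "l \<in> {..m}" "r j = r l"
    with pq show "j = l" by (simp add: r_def m_def split: if_splits)
  qed
  have img: "?x ` {..n} = w ` {p..q}" "?y ` {..m} = w ` ({1..p} \<union> {q..k})"
    using rng by (metis image_image)+
  have "{w p, w q} \<notin> E"
  proof (rule no_chord[where x = ?x and y = ?y and n = n and m = m])
    show "inj_on ?x {..n}"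
    proof (rule inj_onI)
      fix j l assume "j \<in> {..n}" "l \<in> {..n}" "w (p + j) = w (p + l)"
      then show "j = l" using inj_onD[OF inj, of "p + j" "p + l"] pq by (auto simp: n_def)
    qed
    show "inj_on ?y {..m}"
    proof (rule inj_onI)
      fix j l assume *: "j \<in> {..m}" "l \<in> {..m}" "w (r j) = w (r l)"
      then have "r j \<in> {1..k}" "r l \<in> {1..k}" using pq by (auto simp: r_def m_def)
      with * have "r j = r l" using inj_onD[OF inj] by blast
      with * \<open>inj_on r {..m}\<close> show "j = l" by (auto dest: inj_onD)
    qed
    show "walk_edges ?x n \<subseteq> E" "walk_edges ?y m \<subseteq> E" using edges cE by auto
    \<comment> \<open>\<open>n = 1\<close> would mean \<open>q = Suc p\<close>, and
      \<open>m = 1\<close> would mean \<open>p = 1\<close> and \<open>q = k\<close>.\<close>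
    show "2 \<le> n" "2 \<le> m" using pq not_cyc by (auto simp: n_def m_def)
    show "?x 0 = w p" "?x n = w q" "?y 0 = w p" "?y m = w q"
      using pq by (auto simp: n_def m_def r_def)
    have "w ` {p..q} \<inter> w ` ({1..p} \<union> {q..k}) = w ` ({p..q} \<inter> ({1..p} \<union> {q..k}))"
      using pq by (intro inj_on_image_Int[OF inj, symmetric]) auto
    also have "{p..q} \<inter> ({1..p} \<union> {q..k}) = {p, q}" using pq by auto
    finally show "?x ` {..n} \<inter> ?y ` {..m} = {w p, w q}" by (simp add: img)
    have "w ` {p..q} \<union> w ` ({1..p} \<union> {q..k}) \<subseteq> w ` {1..k}" using pq by auto
    then show "?x ` {..n} \<union> ?y ` {..m} \<subseteq> neighbourhood E u \<union> neighbourhood E v"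
      using nb unfolding img by blast
  qed (use outer u v \<open>{u, v} \<in> E\<close> in \<open>simp_all add: edges\<close>)
  with E show False by simp
qed

end

section \<open>The edge set and the resulting monomial\<close>

text \<open>Edges at a hub are given by the neighbourhoods; any other edge joins two cycle vertices
  and, as there is no chord, is a cycle edge. The hubs are not cycle vertices because those lie on
  the curve and the hubs inside it.\<close>

lemma (in plane_graph) double_wheel_edges:
  assumes cyc: "is_cycle E w k"
    and outer: "frontier (outer_face V E pos \<gamma>) = edge_points \<gamma> (cycle_edges w k)"
    and V: "V = w ` {1..k} \<union> {u, v}"
    and u: "pos u \<in> inside (edge_points \<gamma> (cycle_edges w k))"
    and v: "pos v \<in> inside (edge_points \<gamma> (cycle_edges w k))"
    and i: "3 \<le> i" "i < k"
    and Nu: "neighbourhood E u = {v} \<union> w ` {1..i}"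
    and Nv: "neighbourhood E v = {u} \<union> w ` {i..k} \<union> {w 1}"
  shows "u \<notin> w ` {1..k}" "v \<notin> w ` {1..k}"
    and "E - {{w k, w 1}, {w 1, w 2}} = {{u, v}} \<union> (\<lambda>j. {u, w j}) ` {1..i}
      \<union> (\<lambda>j. {v, w j}) ` insert 1 {i..k} \<union> (\<lambda>j. {w j, w (Suc j)}) ` {2..<k}"
proof -
  have inj: "inj_on w {1..k}" and cE: "cycle_edges w k \<subseteq> E"
    using cyc by (auto simp: is_cycle_def)
  have uE: "{u, x} \<in> E \<longleftrightarrow> x \<in> {v} \<union> w ` {1..i}" for x
    using Nu by (auto simp: neighbourhood_def)
  have vE: "{v, x} \<in> E \<longleftrightarrow> x \<in> {u} \<union> w ` {i..k} \<union> {w 1}" for x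
    using Nv by (auto simp: neighbourhood_def)
  have nb: "w ` {1..k} \<subseteq> neighbourhood E u \<union> neighbourhood E v"
  proof -
    have "{1..k} = {1..i} \<union> {i..k}" using i by auto
    then show ?thesis unfolding Nu Nv by auto
  qed
  have consec: "{w j, w (Suc j)} \<in> cycle_edges w k" if "1 \<le> j" "j < k" for j
    using that unfolding cycle_edges_def by auto
  have "pos (w j) \<in> edge_points \<gamma> (cycle_edges w k)" if "j \<in> {1..k}" for j
  proof (cases "j = k")
    case True
    then show ?thesis
      using pos_in_edge[of "{w k, w 1}" "w k"] cE by (auto simp: edge_points_def cycle_edges_def)
  next
    case False
    with that have "{w j, w (Suc j)} \<in> cycle_edges w k" by (intro consec) auto
    then show ?thesis
      using pos_in_edge[of "{w j, w (Suc j)}" "w j"] cE by (auto simp: edge_points_def)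
  qed
  then show un: "u \<notin> w ` {1..k}" and vn: "v \<notin> w ` {1..k}"
    using u v inside_no_overlap by blast+
  have rim: "{w p, w q} \<in> {{w k, w 1}, {w 1, w 2}} \<union> (\<lambda>j. {w j, w (Suc j)}) ` {2..<k}"
    if "1 \<le> p" "p < q" "q \<le> k" "{w p, w q} \<in> E" for p q
  proof -
    have "q = Suc p \<or> p = 1 \<and> q = k"
      using chord_in_cycle_edges[OF cyc outer u v _ nb that] uE by simp
    moreover have "p = 1 \<or> 2 \<le> p" using that(1) by auto
    ultimately consider "p = 1" "q = k" | "p = 1" "q = 2" | "2 \<le> p" "q = Suc p"
      by auto
    then show ?thesis
      using that(3) by cases (auto simp: insert_commute)
  qed
  show "E - {{w k, w 1}, {w 1, w 2}} = {{u, v}} \<union> (\<lambda>j. {u, w j}) ` {1..i}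
      \<union> (\<lambda>j. {v, w j}) ` insert 1 {i..k} \<union> (\<lambda>j. {w j, w (Suc j)}) ` {2..<k}" (is "_ = ?R")
  proof
    show "E - {{w k, w 1}, {w 1, w 2}} \<subseteq> ?R"
    proof
      fix e assume e: "e \<in> E - {{w k, w 1}, {w 1, w 2}}"
      then obtain a b where ab: "e = {a, b}"
        using edge_card[of e] by (auto simp: card_2_iff)
      then have ne: "a \<noteq> b" and "a \<in> V" "b \<in> V"
        using e edge_vertices[of a b] by auto
      have "u \<in> e \<or> v \<in> e \<or> e \<subseteq> w ` {1..k}"
        using \<open>a \<in> V\<close> \<open>b \<in> V\<close> ab V by auto
      then consider x where "e = {u, x}" | x where "e = {v, x}" | "e \<subseteq> w ` {1..k}"
        using ab by (metis insertE insert_commute singletonD)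
      then show "e \<in> ?R"
      proof cases
        case (1 x)
        with e uE[of x] show ?thesis by auto
      next
        case (2 x)
        with e vE[of x] show ?thesis by (auto simp: insert_commute)
      next
        case 3
        with ab obtain p q where pq: "p \<in> {1..k}" "q \<in> {1..k}" "a = w p" "b = w q" by auto
        with ne have "p \<noteq> q" by auto
        then have "e \<in> {{w k, w 1}, {w 1, w 2}} \<union> (\<lambda>j. {w j, w (Suc j)}) ` {2..<k}"
          using rim[of p q] rim[of q p] e ab pq by (cases "p < q") (auto simp: insert_commute)
        with e show ?thesis by auto
      qed
    qed
    show "?R \<subseteq> E - {{w k, w 1}, {w 1, w 2}}"
    proof
      fix e assume "e \<in> ?R"
      then consider "e = {u, v}" | j where "j \<in> {1..i}" "e = {u, w j}"
        | j where "j \<in> insert 1 {i..k}" "e = {v, w j}" | j where "2 \<le> j" "j < k" "e = {w j, w (Suc j)}"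
        by fastforce
      then consider "u \<in> e" "e \<in> E" | "v \<in> e" "e \<in> E" | j where "2 \<le> j" "j < k" "e = {w j, w (Suc j)}"
      proof cases
        case 1
        then show ?thesis using that(1) uE by simp
      next
        case (2 j)
        then show ?thesis using that(1) uE by simp
      next
        case (3 j)
        then show ?thesis using that(2) vE by auto
      next
        case (4 j)
        then show ?thesis by (rule that(3))
      qed
      then show "e \<in> E - {{w k, w 1}, {w 1, w 2}}"
      proof cases
        case 1
        moreover have "u \<notin> {w k, w 1}" "u \<notin> {w 1, w 2}" using un i by auto
        ultimately show ?thesis by blast
      next
        case 2
        moreover have "v \<notin> {w k, w 1}" "v \<notin> {w 1, w 2}" using vn i by auto
        ultimately show ?thesis by blast
      next
        case (3 j)
        \<comment> \<open>Both deleted edges contain \<open>w 1\<close>, so it is enough that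
          \<open>e\<close> does not.\<close>
        have "w 1 \<notin> e"
          using 3 by (simp add: inj_on_eq_iff[OF inj])
        moreover have "e \<in> E" using 3 consec[of j] cE by auto
        ultimately show ?thesis by auto
      qed
    qed
  qed
qed

theorem theorem5p16:
  fixes V :: "'a set" and E :: "'a set set"
    and pos :: "'a \<Rightarrow> complex" and \<gamma> :: "'a set \<Rightarrow> real \<Rightarrow> complex"
    and w :: "nat \<Rightarrow> 'a" and k i :: nat and u v :: 'a
    and lt :: "'a \<Rightarrow> 'a \<Rightarrow> bool"
  assumes "plane_graph V E pos \<gamma>"
    and "is_cycle E w k"
    and "frontier (outer_face V E pos \<gamma>) = edge_points \<gamma> (cycle_edges w k)"
    and "V = w ` {1..k} \<union> {u, v}"
    and "u \<noteq> v"
    and "pos u \<in> inside (edge_points \<gamma> (cycle_edges w k))"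
    and "pos v \<in> inside (edge_points \<gamma> (cycle_edges w k))"
    and "3 \<le> i" and "i \<le> k - 1"
    and "neighbourhood E u = {v} \<union> w ` {1..i}"
    and "neighbourhood E v = {u} \<union> w ` {i..k} \<union> {w 1}"
    and "orientation E lt"
  shows "\<exists>m :: 'a \<Rightarrow>\<^sub>0 nat.
    nonvanishing_monomial
      (graph_poly lt (E - {{w k, w 1}, {w 1, w 2}}) :: ('a, 'b::{comm_ring_1, ring_char_0}) mpolynomial) m
    \<and> Poly_Mapping.keys m \<subseteq> V
    \<and> Poly_Mapping.lookup m (w 1) = 0 \<and> Poly_Mapping.lookup m (w 2) = 0 \<and> Poly_Mapping.lookup m (w k) = 0
    \<and> (\<forall>r\<in>{3..k - 1}. Poly_Mapping.lookup m (w r) \<le> 2)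
    \<and> Poly_Mapping.lookup m v \<le> 4 \<and> Poly_Mapping.lookup m u \<le> 4"
proof -
  interpret plane_graph V E pos \<gamma> by (rule assms(1))
  have ik: "i < k" using assms(8,9) by auto
  have inj: "inj_on w {1..k}" using assms(2) by (simp add: is_cycle_def)
  note dw = double_wheel_edges[OF assms(2,3,4,6,7,8) ik assms(10,11)]
  define m where "m = (if even i then Poly_Mapping.single u 4 + Poly_Mapping.single v 3
      else Poly_Mapping.single u (3::nat) + Poly_Mapping.single v 4)
    + (\<Sum>j=3..<k. Poly_Mapping.single (w j) 2)"
  let ?E = "E - {{w k, w 1}, {w 1, w 2}}"
  let ?S = "{1..i} \<union> insert 1 {i..k} \<union> {2..<k} \<union> Suc ` {2..<k}"
  have S: "?S \<subseteq> {1..k}" using assms(8) ik by auto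
  have "inj_on w ?S" using inj S by (rule inj_on_subset)
  moreover have "u \<notin> w ` ?S" "v \<notin> w ` ?S" using dw(1,2) S by blast+
  moreover have "orientation ?E lt" using assms(12) by (simp add: orientation_def)
  ultimately have "graph_poly lt ?E \<simeq> ((var u - var v) * (\<Prod>j=1..i. var u - var (w j))
    * (\<Prod>j\<in>insert 1 {i..k}. var v - var (w j)) * (\<Prod>j=2..<k. var (w j) - var (w (Suc j)))
      :: ('a, 'b) mpolynomial)"
    using assms(5) dw(3) by (intro graph_poly_double_wheel) auto
  then have "Poly_Mapping.lookup (graph_poly lt ?E :: ('a, 'b) mpolynomial) m \<in> {1, - 1}"
    unfolding m_def
    using lookup_graph_poly_double_wheel[OF assms(8) ik inj assms(5) dw(1,2)]
    by (rule lookup_unit_eq_up_to_sign)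
  then have "nonvanishing_monomial (graph_poly lt ?E :: ('a, 'b) mpolynomial) m"
    by (auto simp: nonvanishing_monomial_def)
  \<comment> \<open>The hubs contribute nothing at \<open>w r\<close>, and by injectivity only the
    summand \<open>j = r\<close> can. For \<open>r\<close> equal to 1, 2 or \<open>k\<close> there
    is no such summand, which gives the three exponents 0.\<close>
  moreover have rim: "Poly_Mapping.lookup m (w r) = (if 3 \<le> r \<and> r < k then 2 else 0)"
    if "r \<in> {1..k}" for r
  proof -
    have "w r \<noteq> u" "w r \<noteq> v" using that dw(1,2) by auto
    moreover have "(\<Sum>j=3..<k. (2::nat) when w j = w r) = (\<Sum>j=3..<k. if j = r then 2 else 0)"
      using that by (intro sum.cong) (auto simp: inj_on_eq_iff[OF inj] when_def)
    ultimately show ?thesis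
      by (simp add: m_def lookup_add lookup_sum lookup_single)
  qed
  moreover have hub: "Poly_Mapping.lookup m u \<le> 4 \<and> Poly_Mapping.lookup m v \<le> 4"
  proof -
    have "(\<Sum>j=3..<k. (2::nat) when w j = t) = 0" if "t \<notin> w ` {1..k}" for t
      using that by (intro sum.neutral) (auto simp: when_def)
    then show ?thesis
      using dw(1,2) assms(5) by (simp add: m_def lookup_add lookup_sum lookup_single)
  qed
  moreover have "Poly_Mapping.keys m \<subseteq> V"
  proof
    fix t assume t: "t \<in> Poly_Mapping.keys m"
    show "t \<in> V"
    proof (rule ccontr)
      assume "t \<notin> V"
      then have "t \<noteq> u" "t \<noteq> v" "t \<notin> w ` {1..k}" using assms(4) by auto
      then have "Poly_Mapping.lookup m t = 0"
        by (auto simp: m_def lookup_add lookup_sum lookup_single when_def intro!: sum.neutral)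
      with t show False by (simp add: in_keys_iff)
    qed
  qed
  ultimately show ?thesis
    using assms(8) ik by (intro exI[of _ m]) auto
qed

end
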